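(* Let $\alpha$ be a nonzero algebraic number and $s\in(0,\infty)$. Then $s$ is $\alpha$-standard if and only if the function $\mu_\alpha$ is infinitely differentiable at $s$.
   Context: For a nonzero algebraic number $\alpha$, $M(\alpha)$ is the logarithmic Mahler measure of its minimal polynomial $a\prod_n(z-\alpha_n)$ over $\mathbb Z$: $M(\alpha)=\log|a|+\sum_n\log^+|\alpha_n|$. For $t\in(0,\infty)$, $M_t(\alpha)=\inf(\sum_{n=1}^N M(\alpha_n)^t)^{1/t}$ and $M_\infty(\alpha)=\inf\max_n M(\alpha_n)$, the infima taken over all factorizations $\alpha=\alpha_1\cdots\alpha_N$ with $\alpha_n\in\overline{\mathbb Q}^{\times}$. Set $\mu_\alpha(t)=M_t(\alpha)$ for $t\in(0,\infty]$. Let $\mathcal X(\mathbb R)$ be the set of real sequences $\mathbf x=(x_1,x_2,\dots)$ with $x_n=0$ for all but finitely many $n$, and put $\|\mathbf x\|_t=(\sum_n|x_n|^t)^{1/t}$ for $t\in(0,\infty)$, $\|\mathbf x\|_\infty=\max_n|x_n|$. A set $I\subseteq(0,\infty]$ is $\alpha$-uniform if there is $\mathbf x\in\mathcal X(\mathbb R)$ with $\mu_\alpha(t)=\|\mathbf x\|_t$ for all $t\in I$. A point $s\in(0,\infty]$ is $\alpha$-standard if it has an $\alpha$-uniform open neighborhood, and $\alpha$-exceptional otherwise. *)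

theory Defs
  imports
    "HOL-Analysis.Analysis"
    "HOL-Computational_Algebra.Computational_Algebra"
begin

text \<open>
  The algebraic closure of the rationals is realised as the set of algebraic complex numbers.
  Irreducibility in the ring of integer polynomials (not over the rationals) forces
  primitivity; the positive leading coefficient removes the remaining sign ambiguity.
\<close>

definition min_int_poly :: "complex \<Rightarrow> int poly" where
  "min_int_poly \<alpha> =
     (THE p. irreducible p \<and> lead_coeff p > 0 \<and> poly (map_poly of_int p) \<alpha> = 0)"

definition log_mahler :: "complex \<Rightarrow> real" where
  "log_mahler \<alpha> =
     ln \<bar>real_of_int (lead_coeff (min_int_poly \<alpha>))\<bar> +
     (\<Sum>z\<in>#proots (map_poly complex_of_int (min_int_poly \<alpha>)). ln (max 1 (cmod z)))"

definition factorizations :: "complex \<Rightarrow> complex list set" where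
  "factorizations \<alpha> =
     {as. as \<noteq> [] \<and> (\<forall>a\<in>set as. algebraic a \<and> a \<noteq> 0) \<and> prod_list as = \<alpha>}"

definition metric_mahler :: "real \<Rightarrow> complex \<Rightarrow> real" where
  "metric_mahler t \<alpha> =
     (INF as\<in>factorizations \<alpha>. (\<Sum>a\<leftarrow>as. log_mahler a powr t) powr (1 / t))"

definition metric_mahler_infinity :: "complex \<Rightarrow> real" where
  "metric_mahler_infinity \<alpha> = (INF as\<in>factorizations \<alpha>. Max (log_mahler ` set as))"

text \<open>
  The parameter interval \<open>(0, \<infinity>]\<close> is the set \<open>{0<..}\<close> of extended reals; values of
  the next two functions outside this set are irrelevant.
\<close>

definition mahler_mu :: "complex \<Rightarrow> ereal \<Rightarrow> real" where
  "mahler_mu \<alpha> t =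
     (if t = \<infinity> then metric_mahler_infinity \<alpha> else metric_mahler (real_of_ereal t) \<alpha>)"

definition seq_norm :: "ereal \<Rightarrow> (nat \<Rightarrow> real) \<Rightarrow> real" where
  "seq_norm t x =
     (if t = \<infinity> then Max (range (\<lambda>n. \<bar>x n\<bar>))
      else (\<Sum>n. \<bar>x n\<bar> powr real_of_ereal t) powr (1 / real_of_ereal t))"

definition finsupp_seqs :: "(nat \<Rightarrow> real) set" where
  "finsupp_seqs = {x. finite {n. x n \<noteq> 0}}"

definition alpha_uniform :: "complex \<Rightarrow> ereal set \<Rightarrow> bool" where
  "alpha_uniform \<alpha> I \<longleftrightarrow>
     I \<subseteq> {0<..} \<and> (\<exists>x\<in>finsupp_seqs. \<forall>t\<in>I. mahler_mu \<alpha> t = seq_norm t x)"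

definition alpha_standard :: "complex \<Rightarrow> ereal \<Rightarrow> bool" where
  "alpha_standard \<alpha> s \<longleftrightarrow>
     (\<exists>U. openin (top_of_set {0<..}) U \<and> s \<in> U \<and> alpha_uniform \<alpha> U)"

text \<open>
  Since \<open>deriv\<close> is total, the existence of the lower derivatives near the point has to
  be demanded explicitly: the derivative of order \<open>n + 1\<close> exists at \<open>s\<close> if that of
  order \<open>n\<close> exists in a neighbourhood of \<open>s\<close> and is differentiable at \<open>s\<close>.
\<close>

fun times_differentiable_at :: "nat \<Rightarrow> (real \<Rightarrow> real) \<Rightarrow> real \<Rightarrow> bool" where
  "times_differentiable_at 0 f s \<longleftrightarrow> True"
| "times_differentiable_at (Suc n) f s \<longleftrightarrow>
     (\<forall>\<^sub>F x in nhds s. times_differentiable_at n f x) \<and>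
     (deriv ^^ n) f differentiable (at s)"

definition infinitely_differentiable_at :: "(real \<Rightarrow> real) \<Rightarrow> real \<Rightarrow> bool" where
  "infinitely_differentiable_at f s \<longleftrightarrow> (\<forall>n. times_differentiable_at n f s)"

end

theory Submission
  imports Defs "HOL-Complex_Analysis.Complex_Analysis" "Jordan_Normal_Form.Char_Poly"
begin

text \<open>
  Near \<open>s\<close> the function \<open>\<mu>\<close> is a minimum of finitely many functions \<open>t \<mapsto> \<parallel>u\<parallel>\<^sub>t\<close>, each of which
  extends holomorphically to a complex neighbourhood of \<open>s\<close>. On either side of \<open>s\<close> a single one of
  them is minimal; if \<open>\<mu>\<close> is smooth at \<open>s\<close>, the two have the same Taylor coefficients there and
  hence coincide.

  For the finiteness let \<open>H\<close> be the group of automorphisms of the algebraic numbers that fix all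
  conjugates of \<open>\<alpha>\<close>. Replace each factor \<open>x\<close> of \<open>\<alpha>\<close> by \<open>N ^ (1 / d)\<close>, where \<open>N\<close> is the product of the
  \<open>H\<close>-orbit of \<open>x\<close> and \<open>d\<close> the size of that orbit. As \<open>H\<close> fixes \<open>\<alpha>\<close>, the new factors multiply to \<open>\<alpha>\<close> up
  to a root of unity, and the measure of each is at most that of the integer polynomial whose roots are
  the conjugates of \<open>N\<close> and whose leading coefficient is that of the minimal polynomial of \<open>x\<close>. This
  polynomial has measure at most \<open>M(x)\<close> and, \<open>H\<close> having finite index, degree bounded in terms of \<open>\<alpha>\<close>. By Northcott's theorem
  only finitely many such measures lie below any given bound.
\<close>

hide_const (open) Module.smult

section \<open>Algebraic integers\<close>

text \<open>Neither the degrees of the factors nor their number is bounded in advance. A root b = N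
  ^ (1 / d) still has unbounded degree, so Northcott's theorem cannot be applied to M(b). It is
  applied to the measure v of the polynomial of bounded degree instead: since M(b) <= v <= M(x),
  replacing the measures of the factors by such values v leaves every infimum unchanged. Extracting
  roots is free because substituting X ^ d for X preserves the measure. The number of factors is
  bounded after discarding zero entries: the positive values v up to M(\<alpha>) are at least some
  \<delta> > 0, so at most (M(\<alpha>) / \<delta>) ^ t of them fit into a sum bounded by
  M(\<alpha>) ^ t. This is uniform only for bounded t, hence the minima on intervals (0, b]. H fixes
  all conjugates of \<alpha>, not \<alpha> alone, in order to be normal: then every automorphism
  permutes the H-orbits, and the norm polynomial is rational. It is integral by a form of Gauss's
  lemma: the leading coefficient times any product of distinct conjugates is an algebraic
  integer.\<close>

definition int_span :: "complex set \<Rightarrow> complex set" where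
  "int_span V = {x. \<exists>f :: complex \<Rightarrow> int. x = (\<Sum>v\<in>V. of_int (f v) * v)}"

text \<open>For a finite nonempty V without 0 this is the multiplier ring of the lattice spanned by
  V. Its elements are algebraic integers, and being a ring it handles sums and products without
  explicit polynomials.\<close>

definition multipliers :: "complex set \<Rightarrow> complex set" where
  "multipliers V = {x. \<forall>v\<in>V. x * v \<in> int_span V}"

lemma int_span_add: "x \<in> int_span V \<Longrightarrow> y \<in> int_span V \<Longrightarrow> x + y \<in> int_span V"
proof -
  assume "x \<in> int_span V" "y \<in> int_span V"
  then obtain f g :: "complex \<Rightarrow> int" where
    "x = (\<Sum>v\<in>V. of_int (f v) * v)" "y = (\<Sum>v\<in>V. of_int (g v) * v)"
    by (auto simp: int_span_def)
  then have "x + y = (\<Sum>v\<in>V. of_int (f v + g v) * v)"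
    by (simp add: sum.distrib algebra_simps)
  then show ?thesis unfolding int_span_def by (intro CollectI exI)
qed

lemma int_span_scale: "x \<in> int_span V \<Longrightarrow> of_int k * x \<in> int_span V"
proof -
  assume "x \<in> int_span V"
  then obtain f :: "complex \<Rightarrow> int" where "x = (\<Sum>v\<in>V. of_int (f v) * v)"
    by (auto simp: int_span_def)
  then have "of_int k * x = (\<Sum>v\<in>V. of_int (k * f v) * v)"
    by (simp add: sum_distrib_left mult.assoc)
  then show ?thesis unfolding int_span_def by (intro CollectI exI)
qed

lemma int_span_0: "0 \<in> int_span V"
  unfolding int_span_def by (auto intro!: exI[of _ "\<lambda>_. 0"])

lemma int_span_sum: "(\<And>i. i \<in> I \<Longrightarrow> g i \<in> int_span V) \<Longrightarrow> (\<Sum>i\<in>I. g i) \<in> int_span V"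
  by (induction I rule: infinite_finite_induct) (auto simp: int_span_0 int_span_add)

lemma int_span_base: "finite V \<Longrightarrow> v \<in> V \<Longrightarrow> v \<in> int_span V"
  unfolding int_span_def
  by (intro CollectI exI[of _ "\<lambda>w. if w = v then 1 else 0"])
    (simp add: if_distribR if_distrib sum.delta cong: if_cong)

lemma int_span_induct:
  assumes "u \<in> int_span V" "\<And>v. v \<in> V \<Longrightarrow> g * v \<in> int_span W"
  shows "g * u \<in> int_span W"
proof -
  obtain f :: "complex \<Rightarrow> int" where f: "u = (\<Sum>v\<in>V. of_int (f v) * v)"
    using assms(1) by (auto simp: int_span_def)
  have "g * u = (\<Sum>v\<in>V. of_int (f v) * (g * v))"
    unfolding f by (simp add: sum_distrib_left algebra_simps)
  also have "\<dots> \<in> int_span W"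
    by (intro int_span_sum int_span_scale assms(2))
  finally show ?thesis .
qed

lemma multipliers_mult_span: "x \<in> multipliers V \<Longrightarrow> u \<in> int_span V \<Longrightarrow> x * u \<in> int_span V"
  by (rule int_span_induct) (auto simp: multipliers_def)

lemma multipliers_add: "x \<in> multipliers V \<Longrightarrow> y \<in> multipliers V \<Longrightarrow> x + y \<in> multipliers V"
  by (auto simp: multipliers_def algebra_simps int_span_add)

lemma multipliers_mult: "x \<in> multipliers V \<Longrightarrow> y \<in> multipliers V \<Longrightarrow> x * y \<in> multipliers V"
  using multipliers_mult_span[of x V] by (auto simp: multipliers_def mult.assoc)

lemma multipliers_Ints: "finite V \<Longrightarrow> x \<in> \<int> \<Longrightarrow> x \<in> multipliers V"
  by (auto simp: multipliers_def elim!: Ints_cases intro!: int_span_scale int_span_base)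

text \<open>The coefficients expressing \<open>x * v\<close> through \<open>V\<close> form an integer matrix with eigenvalue
  \<open>x\<close>, so \<open>x\<close> is a root of its characteristic polynomial.\<close>

lemma multipliers_algebraic_int:
  assumes "finite V" "V \<noteq> {}" "0 \<notin> V" "x \<in> multipliers V"
  shows "algebraic_int x"
proof -
  obtain vs where vs: "set vs = V" "distinct vs"
    using finite_distinct_list[OF assms(1)] by blast
  define n where "n = length vs"
  have "\<forall>v\<in>V. \<exists>f :: complex \<Rightarrow> int. x * v = (\<Sum>w\<in>V. of_int (f w) * w)"
    using assms(4) by (auto simp: multipliers_def int_span_def)
  then obtain F :: "complex \<Rightarrow> complex \<Rightarrow> int" where
    F: "\<And>v. v \<in> V \<Longrightarrow> x * v = (\<Sum>w\<in>V. of_int (F v w) * w)"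
    by metis
  define M :: "int mat" where "M = mat n n (\<lambda>(i,j). F (vs ! i) (vs ! j))"
  define MC :: "complex mat" where "MC = map_mat of_int M"
  define v :: "complex vec" where "v = vec n (\<lambda>i. vs ! i)"
  have M: "M \<in> carrier_mat n n" by (simp add: M_def)
  have MC: "MC \<in> carrier_mat n n" using M by (simp add: MC_def)
  have n0: "n > 0" using assms(2) vs by (auto simp: n_def)
  have "eigenvector MC v x"
    unfolding eigenvector_def
  proof (intro conjI)
    show "v \<in> carrier_vec (dim_row MC)" using MC by (simp add: v_def)
    show "v \<noteq> 0\<^sub>v (dim_row MC)"
    proof
      assume "v = 0\<^sub>v (dim_row MC)"
      then have "v $ 0 = 0\<^sub>v (dim_row MC) $ 0" by simp
      then have "vs ! 0 = 0" using n0 MC by (simp add: v_def)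
      then show False using assms(3) vs n0 nth_mem[of 0 vs] by (auto simp: n_def)
    qed
    show "MC *\<^sub>v v = x \<cdot>\<^sub>v v"
    proof (rule eq_vecI)
      fix i assume "i < dim_vec (x \<cdot>\<^sub>v v)"
      then have i: "i < n" by (simp add: v_def)
      have "(MC *\<^sub>v v) $ i = (\<Sum>j = 0..<n. of_int (F (vs ! i) (vs ! j)) * vs ! j)"
        using i by (simp add: MC_def M_def v_def scalar_prod_def)
      also have "\<dots> = (\<Sum>w\<in>V. of_int (F (vs ! i) w) * w)"
        by (rule sum.reindex_bij_betw)
          (use bij_betw_nth[OF vs(2), of "{..<n}" V] vs in \<open>simp add: n_def atLeast0LessThan\<close>)
      also have "\<dots> = x * vs ! i"
        using F[of "vs ! i"] i vs(1) nth_mem[of i vs] by (simp add: n_def)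
      finally show "(MC *\<^sub>v v) $ i = (x \<cdot>\<^sub>v v) $ i"
        using i by (simp add: v_def)
    qed (use MC in \<open>simp add: v_def\<close>)
  qed
  then have "poly (char_poly MC) x = 0"
    using eigenvalue_root_char_poly[OF MC] by (auto simp: eigenvalue_def)
  moreover have "char_poly MC = map_poly of_int (char_poly M)"
    unfolding MC_def by (rule of_int_hom.char_poly_hom[OF M])
  moreover have "lead_coeff (char_poly M) = 1"
    using degree_monic_char_poly[OF M] by simp
  ultimately show ?thesis
    unfolding algebraic_int_altdef_ipoly by metis
qed

text \<open>W generates the module V[y]: a monic relation of degree n brings v * y ^ n back to lower
  powers. The coefficients may be any multipliers of V, and this freedom yields integral
  closedness.\<close>

lemma multipliers_adjoin:
  assumes "finite V" "V \<noteq> {}" "0 \<notin> V"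
    and "y \<noteq> 0" "\<And>i. i < n \<Longrightarrow> c i \<in> multipliers V" "y ^ n = (\<Sum>i<n. c i * y ^ i)"
  obtains W where "finite W" "W \<noteq> {}" "0 \<notin> W" "multipliers V \<subseteq> multipliers W" "y \<in> multipliers W"
proof
  define W where "W = (\<lambda>(v, j). v * y ^ j) ` (V \<times> {..<n})"
  have n: "n > 0" using assms(4,6) by (cases n) auto
  show W: "finite W" "W \<noteq> {}" "0 \<notin> W" using assms n by (auto simp: W_def)
  have W_I: "y ^ j * u \<in> int_span W" if "u \<in> int_span V" "j < n" for u j
    using that(1) by (rule int_span_induct)
      (use that W in \<open>auto intro!: int_span_base simp: W_def mult.commute\<close>)
  show "multipliers V \<subseteq> multipliers W"
  proof
    fix x assume x: "x \<in> multipliers V"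
    have "x * (v * y ^ j) \<in> int_span W" if "v \<in> V" "j < n" for v j
      using W_I[of "x * v" j] x that by (auto simp: multipliers_def algebra_simps)
    then show "x \<in> multipliers W" by (auto simp: multipliers_def W_def)
  qed
  have "y * (v * y ^ j) \<in> int_span W" if "v \<in> V" "j < n" for v j
  proof (cases "Suc j < n")
    case True
    then show ?thesis
      using W_I[of v "Suc j"] int_span_base[OF assms(1) that(1)] by (simp add: algebra_simps)
  next
    case False
    then have "n = Suc j" using that by simp
    then have "y * (v * y ^ j) = v * y ^ n" by (simp add: algebra_simps)
    also have "\<dots> = (\<Sum>i<n. y ^ i * (c i * v))"
      unfolding assms(6) by (simp add: sum_distrib_left algebra_simps)
    also have "\<dots> \<in> int_span W"
      using assms(5) that by (intro int_span_sum W_I) (auto simp: multipliers_def)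
    finally show ?thesis .
  qed
  then show "y \<in> multipliers W" by (auto simp: multipliers_def W_def)
qed

lemma algebraic_int_power_eq:
  assumes "algebraic_int (y :: complex)"
  obtains n c where "\<And>i. c i \<in> \<int>" "y ^ n = (\<Sum>i<n. c i * y ^ i)"
proof -
  obtain p where p: "lead_coeff p = 1" "\<forall>i. coeff p i \<in> \<int>" "poly p y = 0"
    using assms by (auto elim: algebraic_int.cases)
  have "0 = (\<Sum>i\<le>degree p. coeff p i * y ^ i)" using p(3) by (simp add: poly_altdef)
  also have "\<dots> = (\<Sum>i<degree p. coeff p i * y ^ i) + y ^ degree p"
    using p(1) by (simp flip: lessThan_Suc_atMost)
  finally have "y ^ degree p = (\<Sum>i<degree p. - coeff p i * y ^ i)"
    by (simp add: sum_negf eq_neg_iff_add_eq_0 add.commute)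
  then show ?thesis using that[of "\<lambda>i. - coeff p i" "degree p"] p by auto
qed

text \<open>The elements of X are adjoined in turn. With one common lattice, their sums and products
  can be formed in a single multiplier ring.\<close>

lemma multipliers_adjoin_algebraic_ints:
  assumes "finite X" "\<forall>x\<in>X. algebraic_int x"
  obtains V where "finite V" "V \<noteq> {}" "0 \<notin> V" "X \<subseteq> multipliers V"
  using assms
proof (induction X arbitrary: thesis rule: finite_induct)
  case empty
  show ?case by (rule empty(1)[of "{1}"]) auto
next
  case (insert x X)
  obtain V where V: "finite V" "V \<noteq> {}" "0 \<notin> V" "X \<subseteq> multipliers V"
    using insert.IH insert.prems by auto
  show ?case
  \<comment> \<open>Zero is an integer multiplier already; adjoining it could put 0 into the
    generating set.\<close>
  proof (cases "x = 0")
    case True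
    then show ?thesis
      using insert.prems(1)[of V] V multipliers_Ints[of V x] by auto
  next
    case False
    obtain n c where c: "\<And>i. c i \<in> \<int>" "x ^ n = (\<Sum>i<n. c i * x ^ i)"
      by (rule algebraic_int_power_eq[of x]) (use insert.prems(2) in auto)
    obtain W where "finite W" "W \<noteq> {}" "0 \<notin> W" "multipliers V \<subseteq> multipliers W" "x \<in> multipliers W"
      using multipliers_adjoin[OF V(1-3) False _ c(2)] multipliers_Ints[OF V(1)] c(1) by metis
    then show ?thesis using insert.prems(1)[of W] V by auto
  qed
qed

lemma algebraic_int_add:
  assumes "algebraic_int x" "algebraic_int (y :: complex)"
  shows "algebraic_int (x + y)"
proof -
  obtain V where V: "finite V" "V \<noteq> {}" "0 \<notin> V" "{x, y} \<subseteq> multipliers V"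
    using multipliers_adjoin_algebraic_ints[of "{x, y}"] assms by auto
  then show ?thesis by (intro multipliers_algebraic_int[OF V(1-3)] multipliers_add) auto
qed

lemma algebraic_int_mult:
  assumes "algebraic_int x" "algebraic_int (y :: complex)"
  shows "algebraic_int (x * y)"
proof -
  obtain V where V: "finite V" "V \<noteq> {}" "0 \<notin> V" "{x, y} \<subseteq> multipliers V"
    using multipliers_adjoin_algebraic_ints[of "{x, y}"] assms by auto
  then show ?thesis by (intro multipliers_algebraic_int[OF V(1-3)] multipliers_mult) auto
qed

lemma algebraic_int_diff:
  "algebraic_int x \<Longrightarrow> algebraic_int (y :: complex) \<Longrightarrow> algebraic_int (x - y)"
  using algebraic_int_add[of x "-y"] by auto

lemma algebraic_int_power: "algebraic_int (x :: complex) \<Longrightarrow> algebraic_int (x ^ n)"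
  by (induction n) (auto intro: algebraic_int_mult int_imp_algebraic_int)

text \<open>Integral closedness: a lattice for the coefficients is enlarged to one for y.\<close>

lemma algebraic_int_integral:
  fixes y :: complex
  assumes "\<And>i. i < n \<Longrightarrow> algebraic_int (c i)" "y ^ n = (\<Sum>i<n. c i * y ^ i)"
  shows "algebraic_int y"
proof (cases "y = 0")
  case False
  obtain V where V: "finite V" "V \<noteq> {}" "0 \<notin> V" "c ` {..<n} \<subseteq> multipliers V"
    using multipliers_adjoin_algebraic_ints[of "c ` {..<n}"] assms by auto
  obtain W where "finite W" "W \<noteq> {}" "0 \<notin> W" "y \<in> multipliers W"
    using multipliers_adjoin[OF V(1-3) False _ assms(2)] V(4) by (metis image_subset_iff lessThan_iff)
  then show ?thesis by (rule multipliers_algebraic_int)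
qed simp

section \<open>Gauss's lemma for polynomials over the algebraic integers\<close>

definition algint_poly :: "complex poly \<Rightarrow> bool" where
  "algint_poly p \<longleftrightarrow> (\<forall>i. algebraic_int (coeff p i))"

lemma algint_poly_add: "algint_poly p \<Longrightarrow> algint_poly q \<Longrightarrow> algint_poly (p + q)"
  by (simp add: algint_poly_def algebraic_int_add)

lemma algint_poly_diff: "algint_poly p \<Longrightarrow> algint_poly q \<Longrightarrow> algint_poly (p - q)"
  by (simp add: algint_poly_def algebraic_int_diff)

text \<open>With a the leading coefficient and m one less than the degree, a ^ m times the equation
  p(r) = 0 is a monic equation for a * r with integral coefficients.\<close>

lemma algebraic_int_lead_coeff_mult_root:
  assumes "algint_poly p" "poly p r = 0"
  shows "algebraic_int (lead_coeff p * r)"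
proof (cases "degree p")
  case 0
  then have "lead_coeff p = 0" using assms(2) by (auto elim!: degree_eq_zeroE)
  then show ?thesis by simp
next
  case (Suc m)
  let ?a = "lead_coeff p"
  have "0 = ?a ^ m * (\<Sum>i\<le>Suc m. coeff p i * r ^ i)"
    using assms(2) Suc by (simp add: poly_altdef)
  also have "\<dots> = (\<Sum>i<Suc m. ?a ^ m * (coeff p i * r ^ i)) + ?a ^ m * (?a * r ^ Suc m)"
    using Suc by (simp add: sum_distrib_left ring_distribs flip: lessThan_Suc_atMost)
  also have "(\<Sum>i<Suc m. ?a ^ m * (coeff p i * r ^ i)) =
      (\<Sum>i<Suc m. (coeff p i * ?a ^ (m - i)) * (?a * r) ^ i)"
  proof (rule sum.cong)
    fix i assume "i \<in> {..<Suc m}"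
    then have "?a ^ m = ?a ^ (m - i) * ?a ^ i" by (simp flip: power_add)
    then show "?a ^ m * (coeff p i * r ^ i) = (coeff p i * ?a ^ (m - i)) * (?a * r) ^ i"
      by (simp add: power_mult_distrib)
  qed simp
  also have "?a ^ m * (?a * r ^ Suc m) = (?a * r) ^ Suc m"
    by (simp add: power_mult_distrib algebra_simps)
  finally have "(?a * r) ^ Suc m = (\<Sum>i<Suc m. - (coeff p i * ?a ^ (m - i)) * (?a * r) ^ i)"
    by (simp add: sum_negf eq_neg_iff_add_eq_0 add.commute del: sum.lessThan_Suc power_Suc)
  then show ?thesis
    by (rule algebraic_int_integral[rotated])
      (use assms(1) in \<open>auto simp: algint_poly_def intro!: algebraic_int_mult algebraic_int_power\<close>)
qed

text \<open>Gauss's lemma for a linear factor whose root r may be non-integral. The product has the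
  leading coefficient a of q and the root r, so a and a * r are integral; removing the leading term
  of q therefore keeps the product integral, and the degree drops.\<close>

lemma algint_poly_cancel_linear:
  "algint_poly ([:-r, 1:] * q) \<Longrightarrow> algint_poly q"
proof (induction "degree q" arbitrary: q rule: less_induct)
  case less
  show ?case
  proof (cases "q = 0")
    case False
    let ?a = "lead_coeff q" and ?n = "degree q"
    define q' where "q' = q - monom ?a ?n"
    have "lead_coeff ([:-r, 1:] * q) = ?a" by (simp only: lead_coeff_mult) simp
    then have a: "algebraic_int ?a" "algebraic_int (?a * r)"
      using less.prems algebraic_int_lead_coeff_mult_root[of "[:-r, 1:] * q" r]
      by (metis algint_poly_def, auto)
    have mon: "algint_poly (monom c k)" if "algebraic_int c" for c k
      using that by (simp add: algint_poly_def)
    have "[:-r, 1:] * q' = [:-r, 1:] * q - (monom ?a (Suc ?n) - monom (?a * r) ?n)"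
      unfolding q'_def by (simp add: algebra_simps smult_monom monom_Suc add_monom)
    then have alg: "algint_poly ([:-r, 1:] * q')"
      using a by (simp only:) (intro algint_poly_diff mon less.prems)
    have "algint_poly q'"
    proof (cases "?n = 0")
      case True
      then have "q' = 0" by (auto simp: q'_def monom_0 elim!: degree_eq_zeroE)
      then show ?thesis by (simp add: algint_poly_def)
    next
      case n: False
      have "degree q' < ?n"
      proof (rule degree_lessI)
        show "\<forall>k\<ge>?n. coeff q' k = 0" by (auto simp: q'_def coeff_eq_0)
      qed (use n in simp)
      then show ?thesis using less.hyps alg by blast
    qed
    moreover have "q = q' + monom ?a ?n" by (simp add: q'_def)
    ultimately show ?thesis using algint_poly_add mon a by metis
  qed (simp add: algint_poly_def)
qed

text \<open>The roots outside S are cancelled one by one.\<close>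

lemma algint_poly_sub_roots:
  assumes "finite A" "algint_poly (smult a (\<Prod>w\<in>A. [:-w, 1:]))" "S \<subseteq> A"
  shows "algint_poly (smult a (\<Prod>w\<in>S. [:-w, 1:]))"
proof -
  have "algint_poly (smult a (\<Prod>w\<in>A - T. [:-w, 1:]))" if "finite T" "T \<subseteq> A" for T
    using that
  proof (induction T rule: finite_induct)
    case (insert x T)
    have eq: "A - T = insert x (A - insert x T)" using insert by auto
    have "(\<Prod>w\<in>A - T. [:-w, 1:]) = [:-x, 1:] * (\<Prod>w\<in>A - insert x T. [:-w, 1:])"
      unfolding eq by (rule prod.insert) (use assms(1) in auto)
    then have "algint_poly ([:-x, 1:] * smult a (\<Prod>w\<in>A - insert x T. [:-w, 1:]))"
      using insert by (simp del: mult_pCons_left)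
    then show ?case by (rule algint_poly_cancel_linear)
  qed (use assms(2) in simp)
  from this[of "A - S"] show ?thesis
    using assms by (simp add: finite_subset double_diff)
qed

text \<open>Up to sign this number is the constant coefficient of the polynomial with root set S.
  Applied to a minimal polynomial, it gives the integrality of the norm polynomials.\<close>

lemma algebraic_int_mult_prod_roots:
  assumes "finite A" "algint_poly (smult a (\<Prod>w\<in>A. [:-w, 1:]))" "S \<subseteq> A"
  shows "algebraic_int (a * \<Prod>S)"
proof -
  have "algebraic_int (coeff (smult a (\<Prod>w\<in>S. [:-w, 1:])) 0)"
    using algint_poly_sub_roots[OF assms] unfolding algint_poly_def by blast
  also have "coeff (smult a (\<Prod>w\<in>S. [:-w, 1:])) 0 = (-1) ^ card S * (a * \<Prod>S)"
    by (simp add: poly_prod prod_uminus flip: poly_0_coeff_0)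
  finally show ?thesis by (cases "even (card S)") auto
qed

section \<open>The ring of algebraic numbers\<close>

lemma algebraic_imp_int_multiple:
  assumes "algebraic (x :: complex)"
  obtains c :: int where "c \<noteq> 0" "algebraic_int (of_int c * x)"
proof -
  obtain p :: "int poly" where p: "p \<noteq> 0" "poly (map_poly of_int p) x = 0"
    using assms by (auto elim!: algebraicE')
  have "algint_poly (map_poly of_int p)"
    by (auto simp: algint_poly_def coeff_map_poly intro: int_imp_algebraic_int)
  from algebraic_int_lead_coeff_mult_root[OF this p(2)]
  show ?thesis using that[of "lead_coeff p"] p by (simp add: coeff_map_poly degree_map_poly)
qed

lemma algebraic_if_int_multiple:
  assumes "(c :: int) \<noteq> 0" "algebraic_int (of_int c * x)"
  shows "algebraic (x :: complex)"
proof -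
  obtain p where p: "lead_coeff p = 1" "\<forall>i. coeff p i \<in> \<int>" "poly p (of_int c * x) = 0"
    using assms(2) by (auto elim: algebraic_int.cases)
  show ?thesis
  proof (rule algebraicI)
    show "coeff (pcompose p [:0, of_int c:]) i \<in> \<int>" for i
      using p(2) by (simp add: coeff_pcompose_linear)
    show "pcompose p [:0, of_int c:] \<noteq> 0"
      using assms(1) p(1) by (auto simp: pcompose_eq_0_iff)
  qed (use p in \<open>simp add: poly_pcompose mult.commute\<close>)
qed

lemma algebraic_add:
  assumes "algebraic x" "algebraic (y :: complex)"
  shows "algebraic (x + y)"
proof -
  obtain c d :: int where cd: "c \<noteq> 0" "d \<noteq> 0"
    "algebraic_int (of_int c * x)" "algebraic_int (of_int d * y)"
    using assms by (auto elim!: algebraic_imp_int_multiple)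
  have "algebraic_int (of_int d * (of_int c * x) + of_int c * (of_int d * y))"
    using algebraic_int_add[OF algebraic_int_mult[OF _ cd(3)] algebraic_int_mult[OF _ cd(4)]]
    by (simp add: int_imp_algebraic_int)
  then have "algebraic_int (of_int (c * d) * (x + y))" by (simp add: algebra_simps)
  then show ?thesis using cd by (intro algebraic_if_int_multiple[of "c * d"]) auto
qed

lemma algebraic_mult:
  assumes "algebraic x" "algebraic (y :: complex)"
  shows "algebraic (x * y)"
proof -
  obtain c d :: int where cd: "c \<noteq> 0" "d \<noteq> 0"
    "algebraic_int (of_int c * x)" "algebraic_int (of_int d * y)"
    using assms by (auto elim!: algebraic_imp_int_multiple)
  have "algebraic_int ((of_int c * x) * (of_int d * y))"
    using algebraic_int_mult[OF cd(3,4)] .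
  then have "algebraic_int (of_int (c * d) * (x * y))" by (simp add: algebra_simps)
  then show ?thesis using cd by (intro algebraic_if_int_multiple[of "c * d"]) auto
qed

lemma algebraic_sum:
  "(\<And>i. i \<in> I \<Longrightarrow> algebraic (f i :: complex)) \<Longrightarrow> algebraic (sum f I)"
  by (induction I rule: infinite_finite_induct) (auto intro: algebraic_add)

lemma algebraic_prod:
  "(\<And>i. i \<in> I \<Longrightarrow> algebraic (f i :: complex)) \<Longrightarrow> algebraic (prod f I)"
  by (induction I rule: infinite_finite_induct) (auto intro: algebraic_mult rat_imp_algebraic)

section \<open>Automorphisms of the algebraic numbers\<close>

text \<open>A partial homomorphism is represented by its graph. Its domain is a subring of the
  algebraic numbers; injectivity is automatic there.\<close>

definition partial_hom :: "(complex \<times> complex) set \<Rightarrow> bool" where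
  "partial_hom \<Gamma> \<longleftrightarrow> (1, 1) \<in> \<Gamma> \<and>
     (\<forall>x x' y y'. (x, x') \<in> \<Gamma> \<longrightarrow> (y, y') \<in> \<Gamma> \<longrightarrow>
        (x + y, x' + y') \<in> \<Gamma> \<and> (x - y, x' - y') \<in> \<Gamma> \<and> (x * y, x' * y') \<in> \<Gamma>) \<and>
     (\<forall>x x'. (x, x') \<in> \<Gamma> \<longrightarrow> algebraic x) \<and>
     (\<forall>x'. (0, x') \<in> \<Gamma> \<longrightarrow> x' = 0)"

text \<open>Application of the homomorphism to the coefficients of \<open>p\<close>, as a relation
  because the homomorphism is a graph.\<close>

definition rel_poly :: "(complex \<times> complex) set \<Rightarrow> complex poly \<Rightarrow> complex poly \<Rightarrow> bool" where
  "rel_poly \<Gamma> p p' \<longleftrightarrow> (\<forall>i. (coeff p i, coeff p' i) \<in> \<Gamma>)"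

context
  fixes \<Gamma> :: "(complex \<times> complex) set"
  assumes hom: "partial_hom \<Gamma>"
begin

lemma partial_hom_1: "(1, 1) \<in> \<Gamma>"
  and partial_hom_add: "(x, x') \<in> \<Gamma> \<Longrightarrow> (y, y') \<in> \<Gamma> \<Longrightarrow> (x + y, x' + y') \<in> \<Gamma>"
  and partial_hom_diff: "(x, x') \<in> \<Gamma> \<Longrightarrow> (y, y') \<in> \<Gamma> \<Longrightarrow> (x - y, x' - y') \<in> \<Gamma>"
  and partial_hom_mult: "(x, x') \<in> \<Gamma> \<Longrightarrow> (y, y') \<in> \<Gamma> \<Longrightarrow> (x * y, x' * y') \<in> \<Gamma>"
  and partial_hom_algebraic: "(x, x') \<in> \<Gamma> \<Longrightarrow> algebraic x"
  and partial_hom_zeroD: "(0, x') \<in> \<Gamma> \<Longrightarrow> x' = 0"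
  using hom unfolding partial_hom_def by blast+

lemma partial_hom_0: "(0, 0) \<in> \<Gamma>"
  using partial_hom_diff[OF partial_hom_1 partial_hom_1] by simp

lemma partial_hom_unique: "(x, y) \<in> \<Gamma> \<Longrightarrow> (x, y') \<in> \<Gamma> \<Longrightarrow> y = y'"
  using partial_hom_diff[of x y x y'] partial_hom_zeroD[of "y - y'"] by auto

lemma partial_hom_of_nat: "(of_nat n, of_nat n) \<in> \<Gamma>"
  by (induction n) (auto intro: partial_hom_0 partial_hom_1 partial_hom_add)

lemma partial_hom_of_int: "(of_int n, of_int n) \<in> \<Gamma>"
  using partial_hom_of_nat partial_hom_diff[OF partial_hom_0 partial_hom_of_nat]
  by (cases n rule: int_cases2) auto

lemma partial_hom_sum:
  "(\<And>i. i \<in> I \<Longrightarrow> (f i, g i) \<in> \<Gamma>) \<Longrightarrow> (sum f I, sum g I) \<in> \<Gamma>"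
  by (induction I rule: infinite_finite_induct) (auto intro: partial_hom_0 partial_hom_add)

lemma partial_hom_power: "(x, x') \<in> \<Gamma> \<Longrightarrow> (x ^ n, x' ^ n) \<in> \<Gamma>"
  by (induction n) (auto intro: partial_hom_1 partial_hom_mult)

lemma rel_poly_diff: "rel_poly \<Gamma> p p' \<Longrightarrow> rel_poly \<Gamma> q q' \<Longrightarrow> rel_poly \<Gamma> (p - q) (p' - q')"
  by (simp add: rel_poly_def partial_hom_diff)

lemma rel_poly_add: "rel_poly \<Gamma> p p' \<Longrightarrow> rel_poly \<Gamma> q q' \<Longrightarrow> rel_poly \<Gamma> (p + q) (p' + q')"
  by (simp add: rel_poly_def partial_hom_add)

lemma rel_poly_mult: "rel_poly \<Gamma> p p' \<Longrightarrow> rel_poly \<Gamma> q q' \<Longrightarrow> rel_poly \<Gamma> (p * q) (p' * q')"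
  by (auto simp: rel_poly_def coeff_mult intro!: partial_hom_sum partial_hom_mult)

lemma rel_poly_monom: "(x, x') \<in> \<Gamma> \<Longrightarrow> rel_poly \<Gamma> (monom x n) (monom x' n)"
  by (simp add: rel_poly_def partial_hom_0)

lemma rel_poly_of_int: "rel_poly \<Gamma> (map_poly of_int p) (map_poly of_int p)"
  by (simp add: rel_poly_def coeff_map_poly partial_hom_of_int)

lemma partial_hom_poly:
  assumes "rel_poly \<Gamma> p p'" "(x, x') \<in> \<Gamma>"
  shows "(poly p x, poly p' x') \<in> \<Gamma>"
proof -
  let ?n = "max (degree p) (degree p')"
  have "poly q y = (\<Sum>i\<le>n. coeff q i * y ^ i)" if "degree q \<le> n" for q n and y :: complex
    unfolding poly_altdef by (rule sum.mono_neutral_left) (use that in \<open>auto simp: coeff_eq_0\<close>)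
  then have "poly p x = (\<Sum>i\<le>?n. coeff p i * x ^ i)"
    "poly p' x' = (\<Sum>i\<le>?n. coeff p' i * x' ^ i)"
    by simp_all
  then show ?thesis
    using assms by (auto simp: rel_poly_def intro!: partial_hom_sum partial_hom_mult partial_hom_power)
qed

text \<open>Take an integer equation of x with nonzero constant term. The homomorphism turns it into
  an equation for the image 0, where only that term survives.\<close>

lemma partial_hom_inj:
  assumes "(x, 0) \<in> \<Gamma>"
  shows "x = 0"
proof (rule ccontr)
  assume "x \<noteq> 0"
  then obtain p :: "int poly" where p: "coeff p 0 \<noteq> 0" "poly (map_poly of_int p) x = 0"
    using partial_hom_algebraic[OF assms] by (auto elim!: algebraicE'_nonzero)
  have "(poly (map_poly of_int p) x, poly (map_poly of_int p) 0) \<in> \<Gamma>"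
    by (intro partial_hom_poly rel_poly_of_int assms)
  then have "poly (map_poly of_int p) (0 :: complex) = 0" using p partial_hom_zeroD by auto
  then show False using p by (simp add: poly_0_coeff_0 coeff_map_poly)
qed

lemma rel_poly_degree:
  assumes "rel_poly \<Gamma> p p'"
  shows "degree p' = degree p"
proof -
  have "coeff p i = 0 \<longleftrightarrow> coeff p' i = 0" for i
    using assms partial_hom_inj partial_hom_zeroD unfolding rel_poly_def by metis
  then show ?thesis by (simp add: degree_def)
qed

text \<open>The leading terms cancel in \<open>lead_coeff p * q - lead_coeff q * X^k * p\<close>, so
  the claim reduces to smaller degree without dividing by coefficients.\<close>

lemma rel_poly_vanishes:
  assumes p: "rel_poly \<Gamma> p p'" "p \<noteq> 0" "poly p z = 0" "poly p' w = 0"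
    and minimal: "\<forall>q q'. rel_poly \<Gamma> q q' \<longrightarrow> q \<noteq> 0 \<longrightarrow> poly q z = 0 \<longrightarrow> degree p \<le> degree q"
  shows "rel_poly \<Gamma> q q' \<Longrightarrow> poly q z = 0 \<Longrightarrow> poly q' w = 0"
proof (induction "degree q" arbitrary: q q' rule: less_induct)
  case less
  show ?case
  proof (cases "q = 0")
    case True
    then have "coeff q' i = 0" for i
      using less.prems(1) partial_hom_zeroD by (auto simp: rel_poly_def)
    then have "q' = 0" by (simp add: poly_eq_iff)
    then show ?thesis by simp
  next
    case False
    let ?m = "degree p" and ?n = "degree q"
    have le: "?m \<le> ?n" using minimal less.prems False by blast
    have m: "?m > 0" using p(2,3) by (auto intro!: Nat.gr0I elim!: degree_eq_zeroE)
    define r where "r = monom (coeff p ?m) 0 * q - monom (coeff q ?n) (?n - ?m) * p"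
    define r' where "r' = monom (coeff p' ?m) 0 * q' - monom (coeff q' ?n) (?n - ?m) * p'"
    have r: "rel_poly \<Gamma> r r'"
      unfolding r_def r'_def using p(1) less.prems(1)
      by (intro rel_poly_diff rel_poly_mult rel_poly_monom) (auto simp: rel_poly_def)
    have "degree r < ?n"
    proof (rule degree_lessI)
      show "\<forall>k\<ge>?n. coeff r k = 0"
      proof safe
        fix k assume k: "k \<ge> ?n"
        show "coeff r k = 0"
        proof (cases "k = ?n")
          case True
          then show ?thesis using le by (simp add: r_def coeff_monom_mult)
        next
          case False
          then show ?thesis using k le by (simp add: r_def coeff_monom_mult coeff_eq_0)
        qed
      qed
    qed (use m le in simp)
    moreover have "poly r z = 0" using p less.prems by (simp add: r_def)
    ultimately have "poly r' w = 0" using less.hyps r by blast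
    then have "coeff p' ?m * poly q' w = 0"
      using p(4) by (simp add: r'_def poly_monom)
    moreover have "coeff p' ?m \<noteq> 0"
      using rel_poly_degree[OF p(1)] p(1,2) partial_hom_inj unfolding rel_poly_def
      by (metis leading_coeff_0_iff)
    ultimately show ?thesis by simp
  qed
qed

text \<open>The extension sends q(z) to q'(w). Two representations of one number differ by a
  representation of 0, so \<open>rel_poly_vanishes\<close> is all that well-definedness
  requires.\<close>

lemma partial_hom_extend:
  assumes p: "rel_poly \<Gamma> p p'" "p \<noteq> 0" "poly p z = 0" "poly p' w = 0"
    and minimal: "\<forall>q q'. rel_poly \<Gamma> q q' \<longrightarrow> q \<noteq> 0 \<longrightarrow> poly q z = 0 \<longrightarrow> degree p \<le> degree q"
    and z: "algebraic z"
  obtains \<Delta> where "partial_hom \<Delta>" "\<Gamma> \<subseteq> \<Delta>" "(z, w) \<in> \<Delta>"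
proof
  define \<Delta> where "\<Delta> = {(poly q z, poly q' w) |q q'. rel_poly \<Gamma> q q'}"
  have \<Delta>_I: "(poly q z, poly q' w) \<in> \<Delta>" if "rel_poly \<Gamma> q q'" for q q'
    using that by (auto simp: \<Delta>_def)
  show "\<Gamma> \<subseteq> \<Delta>"
  proof safe
    fix x y assume "(x, y) \<in> \<Gamma>"
    then have "rel_poly \<Gamma> (monom x 0) (monom y 0)" by (rule rel_poly_monom)
    moreover have "x = poly (monom x 0) z" "y = poly (monom y 0) w" by (simp_all add: poly_monom)
    ultimately show "(x, y) \<in> \<Delta>" unfolding \<Delta>_def by blast
  qed
  have "rel_poly \<Gamma> (monom 1 1) (monom 1 1)" by (intro rel_poly_monom partial_hom_1)
  moreover have "z = poly (monom 1 1) z" "w = poly (monom 1 1) w" by (simp_all add: poly_monom)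
  ultimately show "(z, w) \<in> \<Delta>" unfolding \<Delta>_def by blast
  show "partial_hom \<Delta>"
    unfolding partial_hom_def
  proof (intro conjI allI impI)
    show "(1, 1) \<in> \<Delta>" using \<open>\<Gamma> \<subseteq> \<Delta>\<close> partial_hom_1 by blast
  next
    fix x x' y y' assume "(x, x') \<in> \<Delta>" "(y, y') \<in> \<Delta>"
    then obtain q q' r r' where "rel_poly \<Gamma> q q'" "rel_poly \<Gamma> r r'"
      "x = poly q z" "x' = poly q' w" "y = poly r z" "y' = poly r' w"
      by (auto simp: \<Delta>_def)
    then show "(x + y, x' + y') \<in> \<Delta>" "(x - y, x' - y') \<in> \<Delta>" "(x * y, x' * y') \<in> \<Delta>"
      using \<Delta>_I[OF rel_poly_add, of q q' r r'] \<Delta>_I[OF rel_poly_diff, of q q' r r']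
        \<Delta>_I[OF rel_poly_mult, of q q' r r'] by simp_all
  next
    fix x x' assume "(x, x') \<in> \<Delta>"
    then obtain q q' where "rel_poly \<Gamma> q q'" "x = poly q z" by (auto simp: \<Delta>_def)
    moreover have "algebraic (z ^ i)" for i
      by (induction i) (auto intro: algebraic_mult z rat_imp_algebraic)
    ultimately show "algebraic x"
      by (auto simp: poly_altdef rel_poly_def intro!: algebraic_sum algebraic_mult
          intro: partial_hom_algebraic)
  next
    fix x' assume "(0, x') \<in> \<Delta>"
    then obtain q q' where q: "rel_poly \<Gamma> q q'" "poly q z = 0" "x' = poly q' w"
      by (auto simp: \<Delta>_def)
    show "x' = 0" unfolding q(3) by (rule rel_poly_vanishes[OF p minimal q(1,2)])
  qed
qed

text \<open>A substitute for the minimal polynomial of z over the domain of \<Gamma>, which is a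
  ring but perhaps not a field.\<close>

lemma minimal_rel_poly:
  assumes "algebraic z"
  obtains p p' where "rel_poly \<Gamma> p p'" "p \<noteq> 0" "poly p z = 0"
    "\<forall>q q'. rel_poly \<Gamma> q q' \<longrightarrow> q \<noteq> 0 \<longrightarrow> poly q z = 0 \<longrightarrow> degree p \<le> degree q"
proof -
  define Q where "Q = (\<lambda>p. p \<noteq> 0 \<and> poly p z = 0 \<and> (\<exists>p'. rel_poly \<Gamma> p p'))"
  obtain q :: "int poly" where "q \<noteq> 0" "poly (map_poly of_int q) z = 0"
    using assms by (auto elim!: algebraicE')
  then have "Q (map_poly of_int q)" unfolding Q_def using rel_poly_of_int[of q] by auto
  then obtain p where "Q p" "\<And>q. Q q \<Longrightarrow> degree p \<le> degree q"
    using ex_has_least_nat[of Q _ degree] by blast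
  then show ?thesis using that unfolding Q_def by blast
qed

lemma partial_hom_extend_exists:
  assumes "algebraic z"
  obtains \<Delta> w where "partial_hom \<Delta>" "\<Gamma> \<subseteq> \<Delta>" "(z, w) \<in> \<Delta>"
proof -
  obtain p p' where p: "rel_poly \<Gamma> p p'" "p \<noteq> 0" "poly p z = 0"
    "\<forall>q q'. rel_poly \<Gamma> q q' \<longrightarrow> q \<noteq> 0 \<longrightarrow> poly q z = 0 \<longrightarrow> degree p \<le> degree q"
    using minimal_rel_poly[OF assms] by metis
  have "degree p \<noteq> 0" using p(2,3) by (auto elim!: degree_eq_zeroE)
  then have "degree p' \<noteq> 0" using rel_poly_degree[OF p(1)] by simp
  then obtain w where "poly p' w = 0"
    using Fundamental_Theorem_Algebra.fundamental_theorem_of_algebra[of p'] constant_degree[of p'] by auto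
  then show ?thesis using partial_hom_extend[OF p(1-3) _ p(4) assms] that by metis
qed

end

lemma partial_hom_Union:
  assumes "C \<noteq> {}" "\<And>\<Gamma>. \<Gamma> \<in> C \<Longrightarrow> partial_hom \<Gamma>"
    and chain: "\<And>\<Gamma> \<Delta>. \<Gamma> \<in> C \<Longrightarrow> \<Delta> \<in> C \<Longrightarrow> \<Gamma> \<subseteq> \<Delta> \<or> \<Delta> \<subseteq> \<Gamma>"
  shows "partial_hom (\<Union>C)"
  unfolding partial_hom_def
proof (intro conjI allI impI)
  show "(1, 1) \<in> \<Union>C" using assms partial_hom_1 by blast
next
  fix x x' y y' assume "(x, x') \<in> \<Union>C" "(y, y') \<in> \<Union>C"
  then obtain \<Gamma> where "\<Gamma> \<in> C" "(x, x') \<in> \<Gamma>" "(y, y') \<in> \<Gamma>" using chain by blast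
  then show "(x + y, x' + y') \<in> \<Union>C" "(x - y, x' - y') \<in> \<Union>C" "(x * y, x' * y') \<in> \<Union>C"
    using assms(2) partial_hom_add partial_hom_diff partial_hom_mult by blast+
next
  fix x x' assume "(x, x') \<in> \<Union>C"
  then show "algebraic x" using assms(2) partial_hom_algebraic by blast
next
  fix x' assume "(0, x') \<in> \<Union>C"
  then show "x' = 0" using assms(2) partial_hom_zeroD by blast
qed

text \<open>By Zorn's lemma: a maximal graph equals each of its one-element extensions and is
  therefore total.\<close>

lemma partial_hom_total:
  assumes "partial_hom \<Gamma>"
  obtains \<Delta> where "partial_hom \<Delta>" "\<Gamma> \<subseteq> \<Delta>" "\<And>z. algebraic z \<Longrightarrow> \<exists>w. (z, w) \<in> \<Delta>"
proof -
  let ?A = "{\<Delta>. partial_hom \<Delta> \<and> \<Gamma> \<subseteq> \<Delta>}"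
  have "\<exists>M\<in>?A. \<forall>X\<in>?A. M \<subseteq> X \<longrightarrow> X = M"
  proof (rule subset_Zorn_nonempty)
    show "?A \<noteq> {}" using assms by blast
    fix C assume C: "C \<noteq> {}" "subset.chain ?A C"
    have "X \<subseteq> Y \<or> Y \<subseteq> X" if "X \<in> C" "Y \<in> C" for X Y
      using subset.chain_total[OF C(2) that] by blast
    then have "partial_hom (\<Union>C)"
      using C by (intro partial_hom_Union) (auto simp: subset.chain_def)
    moreover have "\<Gamma> \<subseteq> \<Union>C" using C unfolding subset.chain_def by blast
    ultimately show "\<Union>C \<in> ?A" by blast
  qed
  then obtain M where "M \<in> ?A" "\<forall>X\<in>?A. M \<subseteq> X \<longrightarrow> X = M" ..
  then have M: "partial_hom M" "\<Gamma> \<subseteq> M" "partial_hom X \<Longrightarrow> M \<subseteq> X \<Longrightarrow> X = M" for X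
    by auto
  have "\<exists>w. (z, w) \<in> M" if "algebraic z" for z
    using partial_hom_extend_exists[OF M(1) that] M(3) by metis
  then show ?thesis using that M by blast
qed

text \<open>The maps live on all complex numbers, so that composition and
  \<open>inv_into UNIV\<close> form a group; the transcendental numbers are merely permuted.\<close>

definition alg_auts :: "(complex \<Rightarrow> complex) set" where
  "alg_auts = {\<sigma>. bij \<sigma> \<and> (\<forall>x. algebraic (\<sigma> x) \<longleftrightarrow> algebraic x) \<and> \<sigma> 1 = 1 \<and>
     (\<forall>x y. algebraic x \<longrightarrow> algebraic y \<longrightarrow> \<sigma> (x + y) = \<sigma> x + \<sigma> y \<and> \<sigma> (x * y) = \<sigma> x * \<sigma> y)}"

text \<open>Surjectivity comes from finiteness: a total homomorphism maps the root set of an integer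
  polynomial injectively into itself, hence onto.\<close>

lemma partial_hom_alg_aut:
  assumes "partial_hom \<Gamma>"
  obtains \<sigma> where "\<sigma> \<in> alg_auts" "\<And>x y. (x, y) \<in> \<Gamma> \<Longrightarrow> \<sigma> x = y"
proof -
  obtain \<Delta> where \<Delta>: "partial_hom \<Delta>" "\<Gamma> \<subseteq> \<Delta>" "\<And>z. algebraic z \<Longrightarrow> \<exists>w. (z, w) \<in> \<Delta>"
    using partial_hom_total[OF assms] by metis
  \<comment> \<open>The identity outside the algebraic numbers makes \<sigma> a bijection of all
    complex numbers.\<close>
  define \<sigma> where "\<sigma> = (\<lambda>x. if algebraic x then SOME y. (x, y) \<in> \<Delta> else x)"
  have graph: "(x, \<sigma> x) \<in> \<Delta>" if "algebraic x" for x
    using someI_ex[OF \<Delta>(3)[OF that]] that by (simp add: \<sigma>_def)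
  have eqI: "\<sigma> x = y" if "(x, y) \<in> \<Delta>" for x y
    using partial_hom_unique[OF \<Delta>(1) graph that] partial_hom_algebraic[OF \<Delta>(1) that] by blast
  have root: "poly (map_poly of_int p) (\<sigma> x) = 0"
    if "algebraic x" "poly (map_poly of_int p) x = 0" for p x
    using partial_hom_poly[OF \<Delta>(1) rel_poly_of_int[OF \<Delta>(1)] graph[OF that(1)], of p] that(2)
      partial_hom_zeroD[OF \<Delta>(1)] by auto
  have inj: "x = y" if "algebraic x" "algebraic y" "\<sigma> x = \<sigma> y" for x y
    using partial_hom_diff[OF \<Delta>(1) graph[OF that(1)] graph[OF that(2)]] that(3)
      partial_hom_inj[OF \<Delta>(1), of "x - y"] by auto
  have alg: "algebraic (\<sigma> x)" if x: "algebraic x" for x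
  proof -
    obtain p :: "int poly" where "p \<noteq> 0" "poly (map_poly of_int p) x = 0"
      using x by (auto elim!: algebraicE')
    then show ?thesis
      using root[OF x, of p] by (intro algebraicI[of "map_poly of_int p"]) (auto simp: coeff_map_poly)
  qed
  have surj: "\<exists>x. algebraic x \<and> \<sigma> x = y" if y: "algebraic y" for y
  proof -
    obtain p :: "int poly" where p: "p \<noteq> 0" "poly (map_poly of_int p) y = 0"
      using y by (auto elim!: algebraicE')
    let ?R = "{z. poly (map_poly complex_of_int p) z = 0}"
    have R: "algebraic z" if "z \<in> ?R" for z
      using that p by (intro algebraicI[of "map_poly of_int p"]) (auto simp: coeff_map_poly)
    have "\<sigma> ` ?R = ?R"
    proof (rule endo_inj_surj)
      show "finite ?R" using p by (intro poly_roots_finite) auto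
      show "\<sigma> ` ?R \<subseteq> ?R" using R root by blast
      show "inj_on \<sigma> ?R" by (rule inj_onI) (use R inj in blast)
    qed
    moreover have "y \<in> ?R" using p by simp
    ultimately have "y \<in> \<sigma> ` ?R" by simp
    then show ?thesis using R by auto
  qed
  have alg_iff: "algebraic (\<sigma> x) \<longleftrightarrow> algebraic x" for x
    using alg by (auto simp: \<sigma>_def)
  have "bij \<sigma>"
  proof (rule bijI')
    show "\<sigma> x = \<sigma> y \<longleftrightarrow> x = y" for x y
      using inj alg_iff[of x] alg_iff[of y] by (metis \<sigma>_def)
    show "\<exists>x. y = \<sigma> x" for y
      using surj by (metis \<sigma>_def)
  qed
  moreover have "\<sigma> 1 = 1" by (intro eqI partial_hom_1 \<Delta>(1))
  moreover have "\<sigma> (x + y) = \<sigma> x + \<sigma> y" "\<sigma> (x * y) = \<sigma> x * \<sigma> y" if "algebraic x" "algebraic y" for x y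
    using that by (intro eqI partial_hom_add[OF \<Delta>(1)] partial_hom_mult[OF \<Delta>(1)] graph; simp)+
  ultimately have "\<sigma> \<in> alg_auts" using alg_iff by (simp add: alg_auts_def)
  moreover have "\<sigma> x = y" if "(x, y) \<in> \<Gamma>" for x y using that \<Delta>(2) eqI by blast
  ultimately show ?thesis using that by blast
qed

lemma alg_auts_bij: "\<sigma> \<in> alg_auts \<Longrightarrow> bij \<sigma>"
  and alg_auts_algebraic: "\<sigma> \<in> alg_auts \<Longrightarrow> algebraic (\<sigma> x) \<longleftrightarrow> algebraic x"
  and alg_auts_1: "\<sigma> \<in> alg_auts \<Longrightarrow> \<sigma> 1 = 1"
  and alg_auts_add: "\<sigma> \<in> alg_auts \<Longrightarrow> algebraic x \<Longrightarrow> algebraic y \<Longrightarrow> \<sigma> (x + y) = \<sigma> x + \<sigma> y"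
  and alg_auts_mult: "\<sigma> \<in> alg_auts \<Longrightarrow> algebraic x \<Longrightarrow> algebraic y \<Longrightarrow> \<sigma> (x * y) = \<sigma> x * \<sigma> y"
  by (simp_all add: alg_auts_def)

lemma alg_auts_inj: "\<sigma> \<in> alg_auts \<Longrightarrow> inj \<sigma>"
  using alg_auts_bij bij_is_inj by blast

lemma alg_auts_0: "\<sigma> \<in> alg_auts \<Longrightarrow> \<sigma> 0 = 0"
  using alg_auts_add[of \<sigma> 0 0] by simp

lemma alg_auts_uminus: "\<sigma> \<in> alg_auts \<Longrightarrow> algebraic x \<Longrightarrow> \<sigma> (- x) = - \<sigma> x"
  using alg_auts_add[of \<sigma> x "- x"] alg_auts_0[of \<sigma>] by (simp add: eq_neg_iff_add_eq_0 add.commute)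

lemma alg_auts_sum:
  "\<sigma> \<in> alg_auts \<Longrightarrow> (\<And>i. i \<in> I \<Longrightarrow> algebraic (f i)) \<Longrightarrow> \<sigma> (sum f I) = (\<Sum>i\<in>I. \<sigma> (f i))"
  by (induction I rule: infinite_finite_induct)
    (auto simp: alg_auts_0 alg_auts_add algebraic_sum)

lemma alg_auts_prod:
  "\<sigma> \<in> alg_auts \<Longrightarrow> (\<And>i. i \<in> I \<Longrightarrow> algebraic (f i)) \<Longrightarrow> \<sigma> (prod f I) = (\<Prod>i\<in>I. \<sigma> (f i))"
  by (induction I rule: infinite_finite_induct)
    (auto simp: alg_auts_1 alg_auts_mult algebraic_prod)

lemma alg_auts_of_int: "\<sigma> \<in> alg_auts \<Longrightarrow> \<sigma> (of_int n) = of_int n"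
proof -
  assume s: "\<sigma> \<in> alg_auts"
  have "\<sigma> (of_nat m) = of_nat m" for m
    by (induction m) (auto simp: alg_auts_0 alg_auts_1 alg_auts_add rat_imp_algebraic s)
  then show ?thesis
    using alg_auts_uminus[OF s] by (cases n rule: int_cases2) (auto simp: rat_imp_algebraic)
qed

lemma alg_auts_id: "id \<in> alg_auts"
  by (simp add: alg_auts_def)

lemma alg_auts_comp: "\<sigma> \<in> alg_auts \<Longrightarrow> \<tau> \<in> alg_auts \<Longrightarrow> \<sigma> \<circ> \<tau> \<in> alg_auts"
  by (auto simp: alg_auts_def bij_comp)

lemma alg_auts_inv:
  assumes "\<sigma> \<in> alg_auts"
  shows "inv_into UNIV \<sigma> \<in> alg_auts"
proof -
  have inv: "inv_into UNIV \<sigma> (\<sigma> x) = x" "\<sigma> (inv_into UNIV \<sigma> x) = x" for x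
    using alg_auts_bij[OF assms] by (simp_all add: bij_is_inj bij_is_surj surj_f_inv_f)
  have alg: "algebraic (inv_into UNIV \<sigma> x) \<longleftrightarrow> algebraic x" for x
    using alg_auts_algebraic[OF assms, of "inv_into UNIV \<sigma> x"] inv by simp
  have "inv_into UNIV \<sigma> (x + y) = inv_into UNIV \<sigma> x + inv_into UNIV \<sigma> y" "inv_into UNIV \<sigma> (x * y) = inv_into UNIV \<sigma> x * inv_into UNIV \<sigma> y"
    if "algebraic x" "algebraic y" for x y
    using alg_auts_add[OF assms, of "inv_into UNIV \<sigma> x" "inv_into UNIV \<sigma> y"]
      alg_auts_mult[OF assms, of "inv_into UNIV \<sigma> x" "inv_into UNIV \<sigma> y"] that by (metis alg inv)+
  moreover have "inv_into UNIV \<sigma> 1 = 1" using inv(1)[of 1] alg_auts_1[OF assms] by simp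
  ultimately show ?thesis
    using alg alg_auts_bij[OF assms] by (simp add: alg_auts_def bij_imp_bij_inv)
qed

text \<open>A minimal integer polynomial with \<open>x\<close> as its only root is \<open>c * (X - x) ^ D\<close>, and its two
  leading coefficients show that \<open>x\<close> is rational.\<close>

lemma alg_auts_fixed_imp_rational:
  assumes x: "algebraic x" and fixed: "\<And>\<sigma>. \<sigma> \<in> alg_auts \<Longrightarrow> \<sigma> x = x"
  shows "x \<in> \<rat>"
proof -
  define \<Gamma> :: "(complex \<times> complex) set" where "\<Gamma> = range (\<lambda>n. (of_int n, of_int n))"
  have mem: "(a, b) \<in> \<Gamma> \<longleftrightarrow> a \<in> \<int> \<and> a = b" for a b
    by (auto simp: \<Gamma>_def Ints_def)
  have \<Gamma>: "partial_hom \<Gamma>"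
    unfolding partial_hom_def mem by (auto elim!: Ints_cases intro: rat_imp_algebraic)
  obtain p p' where p: "rel_poly \<Gamma> p p'" "p \<noteq> 0" "poly p x = 0"
    "\<forall>q q'. rel_poly \<Gamma> q q' \<longrightarrow> q \<noteq> 0 \<longrightarrow> poly q x = 0 \<longrightarrow> degree p \<le> degree q"
    using minimal_rel_poly[OF \<Gamma> x] by metis
  have p': "p' = p" using p(1) by (simp add: rel_poly_def mem poly_eq_iff)
  have ints: "coeff p i \<in> \<int>" for i using p(1) unfolding rel_poly_def mem by blast
  \<comment> \<open>By minimality of p, the identity on the integers extends to a homomorphism
    taking x to any root y of p, and hence to an automorphism.\<close>
  have only: "y = x" if y: "poly p y = 0" for y
  proof -
    obtain \<Delta> where \<Delta>: "partial_hom \<Delta>" "(x, y) \<in> \<Delta>"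
      by (rule partial_hom_extend[OF \<Gamma> p(1-3) _ p(4) x, of y]) (use y p' in auto)
    obtain \<sigma> where "\<sigma> \<in> alg_auts" "\<sigma> x = y"
      using partial_hom_alg_aut[OF \<Delta>(1)] \<Delta>(2) by metis
    then show "y = x" using fixed[of \<sigma>] by simp
  qed
  define D where "D = order x p"
  have roots: "{z. poly p z = 0} = {x}" by (intro equalityI subsetI) (auto dest: only simp: p(3))
  have eq: "smult (lead_coeff p) ([:-x, 1:] ^ D) = p"
    using complex_poly_decompose[of p] unfolding roots by (simp add: D_def)
  have "D > 0" using p(2,3) by (simp add: D_def order_gt_0_iff)
  then obtain m where m: "D = Suc m" by (cases D) auto
  have "coeff p (D - 1) = coeff (smult (lead_coeff p) ([:-x, 1:] ^ D)) m"
    unfolding eq by (simp add: m)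
  also have "\<dots> = lead_coeff p * (of_nat (D choose m) * (- x))"
    using coeff_linear_poly_power[of m D "-x" 1] by (simp add: m del: power_Suc binomial_Suc_n)
  also have "\<dots> = lead_coeff p * (- of_nat D * x)" by (simp add: m del: of_nat_Suc)
  finally have "coeff p (D - 1) = lead_coeff p * (- of_nat D * x)" .
  then have "x = - coeff p (D - 1) / (lead_coeff p * of_nat D)"
    using p(2) \<open>D > 0\<close> by (simp add: field_simps)
  moreover have "coeff p (D - 1) \<in> \<rat>" "lead_coeff p \<in> \<rat>"
    using ints Ints_subset_Rats by blast+
  ultimately show ?thesis by (metis Rats_divide Rats_minus_iff Rats_mult Rats_of_nat)
qed

section \<open>Mahler measures of integer polynomials\<close>

definition poly_mahler :: "complex poly \<Rightarrow> real" where
  "poly_mahler p = ln (cmod (lead_coeff p)) + (\<Sum>z\<in>#proots p. ln (max 1 (cmod z)))"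

lemma log_mahler_eq: "log_mahler x = poly_mahler (map_poly of_int (min_int_poly x))"
  by (simp add: log_mahler_def poly_mahler_def)

lemma poly_mahler_mult:
  "p \<noteq> 0 \<Longrightarrow> q \<noteq> 0 \<Longrightarrow> poly_mahler (p * q) = poly_mahler p + poly_mahler q"
  by (simp add: poly_mahler_def proots_mult lead_coeff_mult norm_mult ln_mult)

lemma poly_mahler_int_nonneg: "p \<noteq> 0 \<Longrightarrow> 0 \<le> poly_mahler (map_poly of_int p)"
proof -
  assume "p \<noteq> 0"
  then have "\<bar>lead_coeff p\<bar> \<ge> 1" by (metis abs_ge_zero leading_coeff_0_iff abs_0_eq int_one_le_iff_zero_less order_le_less)
  then have "1 \<le> \<bar>real_of_int (lead_coeff p)\<bar>" by linarith
  moreover have "0 \<le> (\<Sum>z\<in>#A. ln (max 1 (cmod z)))" for A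
    by (induction A) auto
  ultimately show ?thesis by (simp add: poly_mahler_def)
qed

section \<open>Minimal integer polynomials\<close>

lemma minimal_degree_int_poly:
  assumes "algebraic (x :: complex)"
  obtains q :: "int poly" where "q \<noteq> 0" "poly (map_poly of_int q) x = 0"
    "\<forall>h. poly (map_poly of_int h) x = 0 \<longrightarrow> (\<exists>c. c \<noteq> 0 \<and> q dvd smult c h)"
proof -
  define Q where "Q = (\<lambda>q :: int poly. q \<noteq> 0 \<and> poly (map_poly of_int q) x = 0)"
  obtain q0 where "Q q0" using assms unfolding Q_def by (auto elim!: algebraicE')
  then obtain q where q: "Q q" "\<forall>h. Q h \<longrightarrow> degree q \<le> degree h"
    using ex_has_least_nat[of Q _ degree] by blast
  have "\<exists>c. c \<noteq> 0 \<and> q dvd smult c h" if h: "poly (map_poly of_int h) x = 0" for h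
  proof -
    have q0: "q \<noteq> 0" using q(1) by (simp add: Q_def)
    \<comment> \<open>Pseudo-division avoids fractions at the price of the factor c. The remainder
      vanishes at x, so by minimality of the degree of q it is 0.\<close>
    obtain c u where c: "c \<noteq> 0" "smult c h = q * u + pseudo_mod h q"
      using pseudo_mod(1)[OF q0, of h] by blast
    have "map_poly complex_of_int (smult c h) = map_poly of_int q * map_poly of_int u + map_poly of_int (pseudo_mod h q)"
      unfolding c(2) by (simp add: hom_distribs)
    moreover have "map_poly complex_of_int (smult c h) = smult (of_int c) (map_poly of_int h)"
      by (simp add: hom_distribs)
    ultimately have "poly (map_poly of_int (pseudo_mod h q)) x = 0"
      using h q(1) by (metis Q_def add_0 mult_zero_left mult_zero_right poly_add poly_mult poly_smult)
    then have "pseudo_mod h q = 0"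
      using q(2) pseudo_mod(2)[OF q0, of h] by (auto simp: Q_def not_le)
    then show ?thesis using c by auto
  qed
  then show ?thesis using that q(1) by (auto simp: Q_def)
qed

text \<open>Irreducible integer polynomials are prime. With q of least degree, p divides c * p = q *
  u. It cannot divide u, since q would then divide a constant; so p divides q and thereby c' * h,
  but not the constant c'.\<close>

lemma irreducible_int_poly_dvd:
  assumes p: "irreducible (p :: int poly)" "poly (map_poly of_int p) (x :: complex) = 0"
    and h: "poly (map_poly of_int h) x = 0"
  shows "p dvd h"
proof -
  have p0: "p \<noteq> 0" using p(1) by auto
  have prime: "prime_elem p" using p(1) by (simp add: prime_elem_iff_irreducible)
  have deg: "degree r \<noteq> 0" if "r \<noteq> 0" "poly (map_poly of_int r) x = 0" for r :: "int poly"
  proof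
    assume "degree r = 0"
    then obtain c where "r = [:c:]" by (elim degree_eq_zeroE)
    then show False using that by (simp add: map_poly_pCons)
  qed
  have "algebraic x"
    using p p0 by (intro algebraicI[of "map_poly of_int p"]) (auto simp: coeff_map_poly)
  then obtain q :: "int poly" where q: "q \<noteq> 0" "poly (map_poly of_int q) x = 0"
    "\<forall>h. poly (map_poly of_int h) x = 0 \<longrightarrow> (\<exists>c. c \<noteq> 0 \<and> q dvd smult c h)"
    by (rule minimal_degree_int_poly)
  obtain c u where c: "c \<noteq> 0" "smult c p = q * u"
    using q(3)[rule_format, OF p(2)] by (auto elim!: dvdE)
  have "p dvd q * u" unfolding c(2)[symmetric] by (simp add: dvd_smult)
  moreover have "\<not> p dvd u"
  proof
    assume "p dvd u"
    then obtain v where "u = p * v" by (elim dvdE)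
    then have "p * [:c:] = p * (q * v)" using c(2) by (simp add: mult_ac)
    then have "[:c:] = q * v" using p0 by (metis mult_left_cancel)
    then have "degree q + degree v = 0" using c(1) q(1)
      by (metis degree_mult_eq degree_pCons_0 mult_zero_right pCons_eq_0_iff)
    then show False using deg[OF q(1,2)] by simp
  qed
  ultimately have "p dvd q" using prime by (simp add: prime_elem_dvd_mult_iff)
  moreover obtain c' where c': "c' \<noteq> 0" "q dvd smult c' h" using q(3)[rule_format, OF h] by blast
  ultimately have "p dvd [:c':] * h" by (simp add: dvd_trans)
  moreover have "\<not> p dvd [:c':]"
  proof
    assume "p dvd [:c':]"
    then have "degree p \<le> degree [:c':]" using c'(1) by (intro dvd_imp_degree_le) auto
    then show False using deg[OF p0 p(2)] by simp
  qed
  ultimately show ?thesis using prime by (simp only: prime_elem_dvd_mult_iff) simp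
qed

lemma irreducible_int_poly_exists:
  assumes "algebraic (x :: complex)"
  obtains p :: "int poly" where "irreducible p" "lead_coeff p > 0" "poly (map_poly of_int p) x = 0"
proof -
  obtain q :: "int poly" where q: "q \<noteq> 0" "poly (map_poly of_int q) x = 0"
    using assms by (auto elim!: algebraicE')
  have factor: "\<exists>p\<in>#A. poly (map_poly of_int p) x = 0"
    if "poly (map_poly of_int (prod_mset A)) x = 0" for A :: "int poly multiset"
    using that by (induction A) (auto simp: hom_distribs)
  have "q dvd prod_mset (prime_factorization q)"
    using prod_mset_prime_factorization_weak[OF q(1)] by (metis associatedD2)
  then obtain u where "prod_mset (prime_factorization q) = q * u" by (elim dvdE)
  then have "poly (map_poly of_int (prod_mset (prime_factorization q))) x = 0"
    using q(2) by (simp add: hom_distribs)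
  then obtain p where p: "p \<in># prime_factorization q" "poly (map_poly of_int p) x = 0"
    using factor by blast
  have irr: "irreducible p" using p(1) in_prime_factors_imp_prime prime_imp_prime_elem prime_elem_imp_irreducible by blast
  show ?thesis
  proof (cases "lead_coeff p > 0")
    case True
    then show ?thesis using that[of p] irr p by simp
  next
    case False
    have "p \<noteq> 0" using irr by auto
    then have "lead_coeff p \<noteq> 0" by simp
    then have "lead_coeff (- p) > 0" using False by (simp del: leading_coeff_0_iff)
    moreover have "irreducible (- p)" using irr by (metis irreducible_def minus_dvd_iff neg_equal_0_iff_equal minus_mult_left minus_minus)
    ultimately show ?thesis using that[of "- p"] p(2) by (simp add: hom_distribs)
  qed
qed

text \<open>The description is unique: two candidates divide each other, so they differ by a unit,
  and the sign of the leading coefficients makes this unit 1.\<close>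

lemma min_int_poly:
  assumes "algebraic x"
  shows "irreducible (min_int_poly x)" "lead_coeff (min_int_poly x) > 0"
    "poly (map_poly of_int (min_int_poly x)) x = 0"
proof -
  let ?P = "\<lambda>p :: int poly. irreducible p \<and> lead_coeff p > 0 \<and> poly (map_poly of_int p) x = 0"
  have "\<exists>!p. ?P p"
  proof (rule ex_ex1I)
    show "\<exists>p. ?P p" using irreducible_int_poly_exists[OF assms] by metis
    fix p q assume pq: "?P p" "?P q"
    then have "p dvd q" "q dvd p" using irreducible_int_poly_dvd by blast+
    then obtain u v where uv: "q = p * u" "p = q * v" by (metis dvdE)
    have pq0: "p \<noteq> 0" "q \<noteq> 0" using pq by auto
    have "p * (u * v) = p * 1" using uv by (metis mult.assoc mult.right_neutral)
    then have "u * v = 1" using pq0 by (metis mult_left_cancel)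
    then have "degree u = 0" "lead_coeff u * lead_coeff v = 1"
      by (metis add_is_0 degree_1 degree_mult_eq mult_zero_left mult_zero_right zero_neq_one)
        (metis \<open>u * v = 1\<close> lead_coeff_1 lead_coeff_mult)
    moreover have "lead_coeff q = lead_coeff p * lead_coeff u" using uv(1) by (simp add: lead_coeff_mult)
    then have "lead_coeff u > 0" using pq by (metis zero_less_mult_pos)
    ultimately have "lead_coeff u = 1" by (metis zmult_eq_1_iff less_minus_one_simps(1) order_less_asym)
    then have "u = 1" using \<open>degree u = 0\<close> by (auto elim!: degree_eq_zeroE)
    then show "p = q" using uv by simp
  qed
  from theI'[OF this] show "irreducible (min_int_poly x)" "lead_coeff (min_int_poly x) > 0"
    "poly (map_poly of_int (min_int_poly x)) x = 0"
    unfolding min_int_poly_def by blast+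
qed

lemma min_int_poly_nonzero: "algebraic x \<Longrightarrow> min_int_poly x \<noteq> 0"
  using min_int_poly(1)[of x] by auto

lemma log_mahler_nonneg: "algebraic x \<Longrightarrow> 0 \<le> log_mahler x"
  unfolding log_mahler_eq by (intro poly_mahler_int_nonneg min_int_poly_nonzero)

text \<open>The minimal polynomial divides h, and the cofactor, a nonzero integer polynomial, has
  measure at least 0.\<close>

lemma log_mahler_le:
  assumes "h \<noteq> 0" "poly (map_poly of_int h) x = 0"
  shows "log_mahler x \<le> poly_mahler (map_poly of_int h)"
proof -
  have x: "algebraic x"
    using assms by (intro algebraicI[of "map_poly of_int h"]) (auto simp: coeff_map_poly)
  obtain u where u: "h = min_int_poly x * u"
    using irreducible_int_poly_dvd[OF min_int_poly(1,3)[OF x] assms(2)] by (elim dvdE)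
  then have "u \<noteq> 0" using assms(1) by auto
  then have "poly_mahler (map_poly of_int h) = log_mahler x + poly_mahler (map_poly of_int u)"
    unfolding u log_mahler_eq using min_int_poly_nonzero[OF x]
    by (simp add: hom_distribs poly_mahler_mult)
  then show ?thesis using poly_mahler_int_nonneg[OF \<open>u \<noteq> 0\<close>] by simp
qed

text \<open>All d roots have absolute value |z| ^ (1 / d), so each contributes the d-th part of the
  right-hand side.\<close>

lemma poly_mahler_monom_minus:
  assumes "d > 0"
  shows "poly_mahler (monom 1 d - [:z:]) = ln (max 1 (cmod z))"
proof -
  let ?r = "monom 1 d - [:z:]"
  have coeff_d: "coeff ?r d = 1" using assms by (simp add: coeff_pCons split: nat.split)
  have deg: "degree ?r = d"
  proof (rule antisym)
    show "degree ?r \<le> d" using assms by (intro degree_diff_le) (auto simp: degree_monom_le)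
    show "d \<le> degree ?r" by (rule le_degree) (simp only: coeff_d, simp)
  qed
  have r0: "?r \<noteq> 0" using coeff_d by (metis coeff_0 zero_neq_one)
  have "ln (max 1 (cmod w)) = ln (max 1 (cmod z)) / d" if "w \<in># proots ?r" for w
  proof -
    have "w ^ d = z" using that r0 by (simp add: poly_monom)
    then have z: "cmod z = cmod w ^ d" by (simp flip: norm_power)
    have "max 1 (cmod z) = max 1 (cmod w) ^ d"
      unfolding z by (cases "cmod w \<le> 1") (auto simp: max_def power_le_one one_le_power not_le
          intro: antisym one_le_power[of "cmod w" d])
    then show ?thesis using assms by (simp add: ln_realpow)
  qed
  then have "(\<Sum>w\<in>#proots ?r. ln (max 1 (cmod w))) = (\<Sum>w\<in>#proots ?r. ln (max 1 (cmod z)) / d)"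
    by (intro arg_cong[of _ _ sum_mset] image_mset_cong)
  also have "\<dots> = ln (max 1 (cmod z))"
    using assms by (simp add: size_proots_complex deg)
  finally show ?thesis by (simp only: poly_mahler_def deg coeff_d) simp
qed

text \<open>Each linear factor X - z becomes X ^ d - z, which has the same measure. This is why
  extracting d-th roots costs nothing.\<close>

lemma poly_mahler_pcompose_monom:
  assumes "d > 0" "p \<noteq> 0"
  shows "poly_mahler (pcompose p (monom 1 d)) = poly_mahler p"
proof -
  have nz: "(\<Prod>z\<in>#A. [:-z, 1:]) \<noteq> 0" for A :: "complex multiset"
    by (auto simp: prod_mset_zero_iff)
  have pc: "pcompose q (monom 1 d) \<noteq> 0" if "q \<noteq> 0" for q :: "complex poly"
    using that assms(1) by (subst pcompose_eq_0_iff) (auto simp: degree_monom_eq)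
  have step: "poly_mahler (pcompose (\<Prod>z\<in>#A. [:-z, 1:]) (monom 1 d)) = (\<Sum>z\<in>#A. ln (max 1 (cmod z)))"
    for A
  proof (induction A)
    case empty
    then show ?case by (simp add: poly_mahler_def)
  next
    case (add x A)
    have lin: "pcompose [:-x, 1:] (monom 1 d) = monom 1 d - [:x:]" by (simp add: pcompose_pCons)
    have "poly_mahler (pcompose (\<Prod>z\<in>#add_mset x A. [:-z, 1:]) (monom 1 d)) =
      poly_mahler (pcompose [:-x, 1:] (monom 1 d)) + poly_mahler (pcompose (\<Prod>z\<in>#A. [:-z, 1:]) (monom 1 d))"
      by (simp only: image_mset_add_mset prod_mset.add_mset pcompose_mult
          poly_mahler_mult[OF pc[of "[:-x, 1:]"] pc[OF nz]] pCons_eq_0_iff one_neq_zero simp_thms not_False_eq_True)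
    then show ?case using add by (simp only: lin poly_mahler_monom_minus[OF assms(1)]) simp
  qed
  have const: "poly_mahler [:c:] = ln (cmod c)" for c by (simp add: poly_mahler_def)
  let ?c = "lead_coeff p" and ?P = "\<Prod>z\<in>#proots p. [:-z, 1:]"
  have p: "p = [:?c:] * ?P" using complex_poly_decompose_multiset[of p] by simp
  have "pcompose p (monom 1 d) = [:?c:] * pcompose ?P (monom 1 d)"
    by (subst p) (simp only: pcompose_mult pcompose_const)
  then have "poly_mahler (pcompose p (monom 1 d)) = ln (cmod ?c) + (\<Sum>z\<in>#proots p. ln (max 1 (cmod z)))"
    using poly_mahler_mult[OF _ pc[OF nz], of "[:?c:]" "proots p"] assms(2) by (simp only: step const) simp
  then show ?thesis by (simp add: poly_mahler_def)
qed

section \<open>Northcott's finiteness theorem\<close>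

lemma cmod_coeff_prod_linear_le:
  "cmod (coeff (\<Prod>z\<in>#A. [:-z, 1:]) i) \<le> (\<Prod>z\<in>#A. 2 * max 1 (cmod z))"
proof (induction A arbitrary: i)
  case empty
  then show ?case by (simp add: coeff_1)
next
  case (add x A)
  let ?Q = "\<Prod>z\<in>#A. [:-z, 1:]" and ?C = "\<Prod>z\<in>#A. 2 * max 1 (cmod z)"
  have C: "0 \<le> ?C" by (rule order_trans[OF norm_ge_zero add.IH])
  have c: "cmod (coeff (pCons 0 ?Q) i) \<le> ?C"
    using add.IH C by (cases i) auto
  have "cmod (coeff (\<Prod>z\<in>#add_mset x A. [:-z, 1:]) i) = cmod (coeff (pCons 0 ?Q) i - x * coeff ?Q i)"
    by simp
  also have "\<dots> \<le> cmod (coeff (pCons 0 ?Q) i) + cmod x * cmod (coeff ?Q i)"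
    by (metis norm_triangle_ineq4 norm_mult)
  \<comment> \<open>Two summands of this size, hence the factor 2 for each root.\<close>
  also have "\<dots> \<le> max 1 (cmod x) * ?C + max 1 (cmod x) * ?C"
  proof (rule add_mono)
    have "1 * ?C \<le> max 1 (cmod x) * ?C" using C by (intro mult_right_mono) auto
    then show "cmod (coeff (pCons 0 ?Q) i) \<le> max 1 (cmod x) * ?C" using c by simp
    show "cmod x * cmod (coeff ?Q i) \<le> max 1 (cmod x) * ?C"
      using add.IH by (intro mult_mono) auto
  qed
  finally show ?case by simp
qed

lemma cmod_coeff_le_poly_mahler:
  assumes "p \<noteq> 0"
  shows "cmod (coeff p i) \<le> 2 ^ degree p * exp (poly_mahler p)"
proof -
  have prod: "(\<Prod>z\<in>#A. 2 * max 1 (cmod z)) = 2 ^ size A * exp (\<Sum>z\<in>#A. ln (max 1 (cmod z)))" for A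
    by (induction A) (simp_all add: exp_add)
  have "coeff p i = lead_coeff p * coeff (\<Prod>z\<in>#proots p. [:-z, 1:]) i"
    by (subst complex_poly_decompose_multiset[of p, symmetric]) (simp only: coeff_smult)
  then have "cmod (coeff p i) \<le> cmod (lead_coeff p) * (\<Prod>z\<in>#proots p. 2 * max 1 (cmod z))"
    by (simp only: norm_mult) (intro mult_left_mono cmod_coeff_prod_linear_le norm_ge_zero)
  also have "\<dots> = 2 ^ degree p * exp (poly_mahler p)"
    using assms by (simp add: prod size_proots_complex poly_mahler_def exp_add)
  finally show ?thesis .
qed

lemma finite_int_polys_bounded:
  "finite {h :: int poly. degree h \<le> k \<and> (\<forall>i. \<bar>coeff h i\<bar> \<le> K)}" (is "finite ?S")
proof (rule inj_on_finite)
  let ?f = "\<lambda>h :: int poly. map (coeff h) [0..<Suc k]"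
  show "inj_on ?f ?S"
  proof (rule inj_onI)
    fix g h assume gh: "g \<in> ?S" "h \<in> ?S" "?f g = ?f h"
    show "g = h"
    proof (rule poly_eqI)
      fix i
      show "coeff g i = coeff h i"
      proof (cases "i \<le> k")
        case True
        then have "i \<in> set [0..<Suc k]" by auto
        then show ?thesis using gh(3) by (simp only: map_eq_conv)
      next
        case False
        then show ?thesis using gh(1,2) by (simp add: coeff_eq_0)
      qed
    qed
  qed
  show "?f ` ?S \<subseteq> {xs. set xs \<subseteq> {-K..K} \<and> length xs = Suc k}"
    by (auto simp: abs_le_iff minus_le_iff simp del: upt_Suc)
  show "finite {xs. set xs \<subseteq> {-K..K} \<and> length xs = Suc k}"
    by (rule finite_lists_length_eq) simp
qed

definition int_poly_measures :: "nat \<Rightarrow> real set" where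
  "int_poly_measures k = {poly_mahler (map_poly of_int h) |h. h \<noteq> 0 \<and> degree h \<le> k}"

text \<open>Bounds on degree and measure bound the integer coefficients by \<open>K\<close>, which
  leaves finitely many polynomials.\<close>

lemma finite_int_poly_measures_le: "finite {v \<in> int_poly_measures k. v \<le> B}"
proof -
  define K where "K = \<lfloor>2 ^ k * exp B\<rfloor>"
  let ?S = "{h :: int poly. degree h \<le> k \<and> (\<forall>i. \<bar>coeff h i\<bar> \<le> K)}"
  have "{v \<in> int_poly_measures k. v \<le> B} \<subseteq> (\<lambda>h. poly_mahler (map_poly of_int h)) ` ?S"
  proof
    fix v assume "v \<in> {v \<in> int_poly_measures k. v \<le> B}"
    then obtain h where h: "h \<noteq> 0" "degree h \<le> k" "v = poly_mahler (map_poly of_int h)" "v \<le> B"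
      by (auto simp: int_poly_measures_def)
    have "\<bar>coeff h i\<bar> \<le> K" for i
    proof -
      have "cmod (coeff (map_poly of_int h) i) \<le> 2 ^ degree (map_poly complex_of_int h) * exp v"
        unfolding h(3) using h(1) by (intro cmod_coeff_le_poly_mahler) auto
      also have "\<dots> \<le> 2 ^ k * exp B"
        using h by (intro mult_mono power_increasing) auto
      finally show ?thesis by (simp add: K_def le_floor_iff)
    qed
    then show "v \<in> (\<lambda>h. poly_mahler (map_poly of_int h)) ` ?S" using h by blast
  qed
  then show ?thesis by (rule finite_subset) (intro finite_imageI finite_int_polys_bounded)
qed

lemma int_poly_measures_nonneg: "v \<in> int_poly_measures k \<Longrightarrow> 0 \<le> v"
  by (auto simp: int_poly_measures_def poly_mahler_int_nonneg)

text \<open>b is a root of h(X ^ d), whose measure is that of h however large d is.\<close>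

lemma log_mahler_radical_le:
  assumes "h \<noteq> 0" "poly (map_poly of_int h) (b ^ d) = 0" "d > 0"
  shows "log_mahler b \<le> poly_mahler (map_poly of_int h)" "algebraic b"
proof -
  define g where "g = pcompose h (monom 1 d)"
  have g: "map_poly complex_of_int g = pcompose (map_poly of_int h) (monom 1 d)"
    unfolding g_def by (simp add: of_int_hom.map_poly_pcompose)
  have "g \<noteq> 0"
    unfolding g_def using assms by (subst pcompose_eq_0_iff) (auto simp: degree_monom_eq)
  moreover have "poly (map_poly of_int g) b = 0"
    unfolding g using assms by (simp add: poly_pcompose poly_monom)
  ultimately show "log_mahler b \<le> poly_mahler (map_poly of_int h)" "algebraic b"
    using log_mahler_le[of g b] poly_mahler_pcompose_monom[OF assms(3), of "map_poly of_int h"] assms(1)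
    by (simp add: g, intro algebraicI[of "map_poly of_int g"]) (auto simp: coeff_map_poly)
qed

text \<open>The case h = X - 1 of the bound for radicals.\<close>

lemma log_mahler_root_of_unity:
  assumes "z ^ d = 1" "d > 0"
  shows "log_mahler z = 0" "algebraic z"
proof -
  have h: "[:-1, 1:] \<noteq> (0 :: int poly)" "poly (map_poly of_int [:-1, 1:]) (z ^ d) = 0"
    using assms by (auto simp: map_poly_pCons)
  show alg: "algebraic z" by (rule log_mahler_radical_le(2)[OF h assms(2)])
  have "map_poly complex_of_int [:-1, 1:] = [:-1, 1:]" by (simp add: map_poly_pCons)
  then have "poly_mahler (map_poly of_int [:-1, 1 :: int:]) = 0"
    by (simp only: poly_mahler_def) simp
  then show "log_mahler z = 0"
    using log_mahler_radical_le(1)[OF h assms(2)] log_mahler_nonneg[OF alg] by simp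
qed

section \<open>Orbits and relative norms\<close>

lemma alg_auts_power: "\<sigma> \<in> alg_auts \<Longrightarrow> algebraic x \<Longrightarrow> \<sigma> (x ^ n) = \<sigma> x ^ n"
  using alg_auts_prod[of \<sigma> "{..<n}" "\<lambda>_. x"] by simp

lemma alg_auts_poly_root:
  assumes s: "\<sigma> \<in> alg_auts" and x: "algebraic x" and h: "poly (map_poly of_int h) x = 0"
  shows "poly (map_poly of_int h) (\<sigma> x) = 0"
proof -
  have alg: "algebraic (x ^ i)" for i using algebraic_prod[of "{..<i}" "\<lambda>_. x"] x by simp
  have "\<sigma> (poly (map_poly of_int h) x) = poly (map_poly of_int h) (\<sigma> x)"
    by (simp add: poly_altdef alg_auts_sum[OF s] alg_auts_mult[OF s] alg algebraic_mult
        rat_imp_algebraic alg_auts_of_int[OF s] alg_auts_power[OF s x])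
  then show ?thesis using h alg_auts_0[OF s] by simp
qed

definition aut_group :: "(complex \<Rightarrow> complex) set \<Rightarrow> bool" where
  "aut_group H \<longleftrightarrow> H \<subseteq> alg_auts \<and> id \<in> H \<and> (\<forall>\<sigma>\<in>H. inv_into UNIV \<sigma> \<in> H) \<and>
     (\<forall>\<sigma>\<in>H. \<forall>\<tau>\<in>H. \<sigma> \<circ> \<tau> \<in> H)"

definition orbit :: "(complex \<Rightarrow> complex) set \<Rightarrow> complex \<Rightarrow> complex set" where
  "orbit H x = (\<lambda>\<sigma>. \<sigma> x) ` H"

lemma orbitI: "\<sigma> \<in> H \<Longrightarrow> \<sigma> x \<in> orbit H x"
  by (simp add: orbit_def)

lemma orbitE: "y \<in> orbit H x \<Longrightarrow> (\<And>\<sigma>. \<sigma> \<in> H \<Longrightarrow> y = \<sigma> x \<Longrightarrow> thesis) \<Longrightarrow> thesis"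
  by (auto simp: orbit_def)

lemma orbit_closed:
  assumes "aut_group H" "\<sigma> \<in> H" "y \<in> orbit H x"
  shows "\<sigma> y \<in> orbit H x"
proof -
  obtain \<tau> where t: "\<tau> \<in> H" "y = \<tau> x" using assms(3) by (elim orbitE)
  then have "\<sigma> \<circ> \<tau> \<in> H" using assms by (simp add: aut_group_def)
  from orbitI[OF this, of x] show ?thesis using t by simp
qed

lemma aut_group_alg_auts: "aut_group alg_auts"
  by (simp add: aut_group_def alg_auts_id alg_auts_inv alg_auts_comp)

lemma inv_alg_aut:
  assumes "\<sigma> \<in> alg_auts"
  shows "inv_into UNIV \<sigma> (\<sigma> x) = x" "\<sigma> (inv_into UNIV \<sigma> x) = x"
  using alg_auts_bij[OF assms] by (simp_all add: bij_is_inj bij_is_surj surj_f_inv_f)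

lemma orbit_self: "aut_group H \<Longrightarrow> x \<in> orbit H x"
  by (auto simp: aut_group_def orbit_def image_iff intro!: bexI[of _ id])

lemma orbit_eq:
  assumes H: "aut_group H" and y: "y \<in> orbit H x"
  shows "orbit H y = orbit H x"
proof -
  have sub: "orbit H v \<subseteq> orbit H u" if "v \<in> orbit H u" for u v
    using orbit_closed[OF H _ that] by (auto elim!: orbitE)
  obtain \<sigma> where s: "\<sigma> \<in> H" "y = \<sigma> x" using y by (auto simp: orbit_def)
  then have "inv_into UNIV \<sigma> \<in> H" "inv_into UNIV \<sigma> y = x"
    using H inv_alg_aut(1)[of \<sigma>] by (auto simp: aut_group_def)
  then have "x \<in> orbit H y" by (auto simp: orbit_def)
  then show ?thesis using sub y by blast
qed

lemma orbit_algebraic: "H \<subseteq> alg_auts \<Longrightarrow> algebraic x \<Longrightarrow> y \<in> orbit H x \<Longrightarrow> algebraic y"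
  by (auto simp: orbit_def alg_auts_algebraic)

lemma orbit_subset_roots:
  assumes "H \<subseteq> alg_auts" "algebraic x"
  shows "orbit H x \<subseteq> {z. poly (map_poly of_int (min_int_poly x)) z = 0}"
  using assms alg_auts_poly_root[OF _ assms(2) min_int_poly(3)[OF assms(2)]]
  by (auto simp: orbit_def)

lemma finite_orbit:
  assumes "H \<subseteq> alg_auts" "algebraic x"
  shows "finite (orbit H x)"
  using min_int_poly_nonzero[OF assms(2)]
  by (intro finite_subset[OF orbit_subset_roots[OF assms]] poly_roots_finite) simp

text \<open>Stated for a family \<open>f\<close> instead of a set of roots, since norms of different
  orbits may coincide and are counted separately.\<close>

lemma alg_aut_coeff_prod_linear:
  assumes s: "\<sigma> \<in> alg_auts" and f: "\<And>i. i \<in> I \<Longrightarrow> algebraic (f i)"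
  shows "algebraic (coeff (\<Prod>i\<in>I. [:- f i, 1:]) n) \<and>
         \<sigma> (coeff (\<Prod>i\<in>I. [:- f i, 1:]) n) = coeff (\<Prod>i\<in>I. [:- \<sigma> (f i), 1:]) n"
  using f
proof (induction I arbitrary: n rule: infinite_finite_induct)
  case (insert x I)
  let ?P = "\<Prod>i\<in>I. [:- f i, 1:]" and ?Q = "\<Prod>i\<in>I. [:- \<sigma> (f i), 1:]"
  have IH: "algebraic (coeff ?P m)" "\<sigma> (coeff ?P m) = coeff ?Q m" for m
    using insert by auto
  have X: "algebraic (coeff (pCons 0 ?P) n)" "\<sigma> (coeff (pCons 0 ?P) n) = coeff (pCons 0 ?Q) n"
    using IH alg_auts_0[OF s] by (auto simp: coeff_pCons split: nat.split)
  have x: "algebraic (f x)" using insert by simp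
  have "coeff (\<Prod>i\<in>insert x I. [:- f i, 1:]) n = coeff (pCons 0 ?P) n + (- (f x * coeff ?P n))"
    "coeff (\<Prod>i\<in>insert x I. [:- \<sigma> (f i), 1:]) n = coeff (pCons 0 ?Q) n + (- (\<sigma> (f x) * coeff ?Q n))"
    using insert by simp_all
  moreover have "\<sigma> (coeff (pCons 0 ?P) n + (- (f x * coeff ?P n))) =
      coeff (pCons 0 ?Q) n + (- (\<sigma> (f x) * coeff ?Q n))"
    using X IH[of n] x
    by (simp only: alg_auts_add[OF s] alg_auts_uminus[OF s] alg_auts_mult[OF s] algebraic_mult
        algebraic_minus_iff)
  moreover have "algebraic (coeff (pCons 0 ?P) n + (- (f x * coeff ?P n)))"
    using X(1) IH(1) x by (intro algebraic_add algebraic_minus algebraic_mult)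
  ultimately show ?case by simp
qed (auto simp: coeff_1 alg_auts_0[OF s] alg_auts_1[OF s])

text \<open>An automorphism only permutes the linear factors, so it fixes every coefficient. The
  permutation acts on indices because \<open>f\<close> may repeat values.\<close>

lemma invariant_prod_linear_rational:
  assumes f: "\<And>i. i \<in> I \<Longrightarrow> algebraic (f i)"
    and inv: "\<And>\<sigma>. \<sigma> \<in> alg_auts \<Longrightarrow> \<exists>\<pi>. bij_betw \<pi> I I \<and> (\<forall>i\<in>I. \<sigma> (f i) = f (\<pi> i))"
  shows "coeff (\<Prod>i\<in>I. [:- f i, 1:]) n \<in> \<rat>"
proof (rule alg_auts_fixed_imp_rational)
  show "algebraic (coeff (\<Prod>i\<in>I. [:- f i, 1:]) n)"
    using alg_aut_coeff_prod_linear[OF alg_auts_id, of I f n] f by simp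
  fix \<sigma> assume s: "\<sigma> \<in> alg_auts"
  then obtain \<pi> where pi: "bij_betw \<pi> I I" "\<forall>i\<in>I. \<sigma> (f i) = f (\<pi> i)" using inv[OF s] by auto
  have "(\<Prod>i\<in>I. [:- \<sigma> (f i), 1:]) = (\<Prod>i\<in>I. [:- f (\<pi> i), 1:])"
    by (rule prod.cong) (use pi(2) in auto)
  also have "\<dots> = (\<Prod>i\<in>I. [:- f i, 1:])"
    by (rule prod.reindex_bij_betw[OF pi(1)])
  finally show "\<sigma> (coeff (\<Prod>i\<in>I. [:- f i, 1:]) n) = coeff (\<Prod>i\<in>I. [:- f i, 1:]) n"
    using alg_aut_coeff_prod_linear[OF s, of I f n] f by simp
qed

lemma clear_denominators:
  fixes p :: "complex poly"
  assumes "\<And>i. coeff p i \<in> \<rat>"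
  shows "\<exists>c g. c \<noteq> 0 \<and> map_poly of_int g = smult (of_int c) p"
  using assms
proof (induction p rule: pCons_induct)
  case 0
  then show ?case by (intro exI[of _ 1] exI[of _ 0]) auto
next
  case (pCons a p)
  have "coeff p i \<in> \<rat>" for i using pCons.prems[of "Suc i"] by simp
  then obtain c g where g: "c \<noteq> 0" "map_poly of_int g = smult (of_int c) p"
    using pCons.IH by blast
  have "a \<in> \<rat>" using pCons.prems[of 0] by simp
  then obtain m n where a: "n > 0" "a = of_int m / of_int n" by (auto elim!: Rats_cases')
  have "map_poly of_int (pCons (c * m) (smult n g)) = smult (of_int (c * n)) (pCons a p)"
    using a g(2) by (simp add: map_poly_pCons hom_distribs mult_ac)
  then show ?case using g(1) a(1) by (intro exI[of _ "c * n"] exI) auto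
qed

text \<open>The orbit product has rational coefficients, so the minimal polynomial divides an
  integer multiple of it; its roots are simple and lie in the orbit. Conversely, automorphisms map
  roots to roots.\<close>

lemma min_int_poly_eq_orbit_prod:
  assumes x: "algebraic x"
  shows "map_poly of_int (min_int_poly x) =
    smult (of_int (lead_coeff (min_int_poly x))) (\<Prod>w\<in>orbit alg_auts x. [:- w, 1:])"
proof -
  let ?O = "orbit alg_auts x" and ?f = "min_int_poly x"
  have fin: "finite ?O" by (rule finite_orbit[OF order.refl x])
  have rat: "coeff (\<Prod>w\<in>?O. [:- w, 1:]) n \<in> \<rat>" for n
  proof (rule invariant_prod_linear_rational)
    show "algebraic w" if "w \<in> ?O" for w by (rule orbit_algebraic[OF order.refl x that])
    fix \<sigma> assume s: "\<sigma> \<in> alg_auts"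
    have "\<sigma> ` ?O \<subseteq> ?O" using orbit_closed[OF aut_group_alg_auts s] by blast
    then have "\<sigma> ` ?O = ?O"
      by (intro endo_inj_surj fin inj_on_subset[OF alg_auts_inj[OF s]]) auto
    then have "bij_betw \<sigma> ?O ?O"
      using inj_on_subset[OF alg_auts_inj[OF s], of ?O] by (simp add: bij_betw_def)
    then show "\<exists>\<pi>. bij_betw \<pi> ?O ?O \<and> (\<forall>w\<in>?O. \<sigma> w = \<pi> w)" by blast
  qed
  obtain c g where g: "c \<noteq> 0" "map_poly of_int g = smult (of_int c) (\<Prod>w\<in>?O. [:- w, 1:])"
    using clear_denominators[OF rat] by blast
  have "poly (\<Prod>w\<in>?O. [:- w, 1:]) x = 0"
    using fin orbit_self[OF aut_group_alg_auts, of x] by (auto simp: poly_prod prod_zero_iff)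
  then have "poly (map_poly of_int g) x = 0" unfolding g(2) by simp
  then obtain u where u: "g = ?f * u"
    using irreducible_int_poly_dvd[OF min_int_poly(1,3)[OF x]] by (auto elim!: dvdE)
  have nz: "(\<Prod>w\<in>?O. [:- w, 1:]) \<noteq> 0" using fin by simp
  then have "map_poly complex_of_int g \<noteq> 0" unfolding g(2) using g(1) by simp
  then have u0: "u \<noteq> 0" unfolding u by auto
  have f0: "?f \<noteq> 0" by (rule min_int_poly_nonzero[OF x])
  have "proots (\<Prod>w\<in>?O. [:- w, 1:]) = mset_set ?O"
    by (subst proots_prod) auto
  then have "mset_set ?O = proots (map_poly complex_of_int g)"
    unfolding g(2) using g(1) by simp
  also have "\<dots> = proots (map_poly of_int ?f) + proots (map_poly of_int u)"
    unfolding u using u0 f0 by (simp add: hom_distribs proots_mult)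
  finally have sub: "proots (map_poly of_int ?f) \<subseteq># mset_set ?O" by simp
  moreover have "mset_set ?O \<subseteq># proots (map_poly of_int ?f)"
  proof (rule mset_subset_eqI)
    fix w
    show "count (mset_set ?O) w \<le> count (proots (map_poly of_int ?f)) w"
    proof (cases "w \<in> ?O")
      case True
      then have "w \<in># proots (map_poly of_int ?f)"
        using orbit_subset_roots[OF order.refl x] f0 by auto
      then show ?thesis using True fin by (simp only: count_mset_set) (simp add: Suc_le_eq count_greater_zero_iff del: count_proots)
    qed (simp add: fin)
  qed
  ultimately have "proots (map_poly of_int ?f) = mset_set ?O" by simp
  then show ?thesis
    using complex_poly_decompose_multiset[of "map_poly of_int ?f"]
    by (simp add: prod_unfold_prod_mset)
qed

lemma poly_mahler_prod_linear:
  assumes "a \<noteq> 0" "finite I"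
  shows "poly_mahler (smult a (\<Prod>i\<in>I. [:- f i, 1:])) = ln (cmod a) + (\<Sum>i\<in>I. ln (max 1 (cmod (f i))))"
  using assms(2)
proof (induction I rule: finite_induct)
  case empty
  then show ?case using assms(1) by (simp add: poly_mahler_def)
next
  case (insert x I)
  have "(\<Prod>i\<in>insert x I. [:- f i, 1:]) = [:- f x, 1:] * (\<Prod>i\<in>I. [:- f i, 1:])"
    by (rule prod.insert[OF insert.hyps])
  then have eq: "smult a (\<Prod>i\<in>insert x I. [:- f i, 1:]) = [:- f x, 1:] * smult a (\<Prod>i\<in>I. [:- f i, 1:])"
    by (simp only: mult_smult_right)
  have "smult a (\<Prod>i\<in>I. [:- f i, 1:]) \<noteq> 0" using assms(1) insert.hyps by simp
  then have "poly_mahler (smult a (\<Prod>i\<in>insert x I. [:- f i, 1:])) =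
      poly_mahler [:- f x, 1:] + poly_mahler (smult a (\<Prod>i\<in>I. [:- f i, 1:]))"
    unfolding eq by (intro poly_mahler_mult) simp_all
  moreover have "poly_mahler [:- f x, 1:] = ln (max 1 (cmod (f x)))"
    by (simp add: poly_mahler_def)
  ultimately show ?case using insert by simp
qed

lemma log_mahler_eq_orbit_sum:
  assumes x: "algebraic x"
  shows "log_mahler x = ln (cmod (of_int (lead_coeff (min_int_poly x)))) +
    (\<Sum>w\<in>orbit alg_auts x. ln (max 1 (cmod w)))"
  unfolding log_mahler_eq
  by (subst min_int_poly_eq_orbit_prod[OF x], rule poly_mahler_prod_linear)
    (use min_int_poly_nonzero[OF x] finite_orbit[OF order.refl x] in auto)

text \<open>Subadditivity of log^+, the only source of loss when the norm polynomial is compared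
  with the minimal polynomial.\<close>

lemma ln_max_prod_le:
  "finite B \<Longrightarrow> ln (max 1 (cmod (\<Prod>B))) \<le> (\<Sum>w\<in>B. ln (max 1 (cmod w)))"
proof (induction B rule: finite_induct)
  case (insert x B)
  have "max 1 (cmod x * cmod (\<Prod>B)) \<le> max 1 (cmod x) * max 1 (cmod (\<Prod>B))"
  proof (rule max.boundedI)
    show "1 \<le> max 1 (cmod x) * max 1 (cmod (\<Prod>B))"
      using mult_mono[of 1 "max 1 (cmod x)" 1 "max 1 (cmod (\<Prod>B))"] by simp
    show "cmod x * cmod (\<Prod>B) \<le> max 1 (cmod x) * max 1 (cmod (\<Prod>B))"
      by (intro mult_mono) auto
  qed
  then have "ln (max 1 (cmod (\<Prod>(insert x B)))) \<le> ln (max 1 (cmod x) * max 1 (cmod (\<Prod>B)))"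
    using insert.hyps by (simp add: norm_mult)
  also have "\<dots> = ln (max 1 (cmod x)) + ln (max 1 (cmod (\<Prod>B)))"
    by (simp add: ln_mult)
  finally show ?case using insert by simp
qed simp

text \<open>The product is expanded one block at a time: \<I> holds the blocks still to be
  multiplied out, \<J> those whose constant term was chosen. In the end a times a product of
  distinct elements remains, because the blocks are disjoint, and \<open>int\<close>
  applies.\<close>

lemma algint_poly_prod_norms:
  assumes fin: "finite \<B>" "\<And>B. B \<in> \<B> \<Longrightarrow> finite B" and disj: "pairwise disjnt \<B>"
    and int: "\<And>S. S \<subseteq> \<Union>\<B> \<Longrightarrow> algebraic_int (a * \<Prod>S)"
  shows "algint_poly (smult a (\<Prod>B\<in>\<B>. [:- \<Prod>B, 1:]))"
proof -
  have "algint_poly (smult (a * (\<Prod>B\<in>\<J>. \<Prod>B)) (\<Prod>B\<in>\<I>. [:- \<Prod>B, 1:]))"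
    if "finite \<I>" "\<I> \<subseteq> \<B>" "\<J> \<subseteq> \<B>" "\<I> \<inter> \<J> = {}" for \<I> \<J>
    using that
  proof (induction \<I> arbitrary: \<J> rule: finite_induct)
    case empty
    have "(\<Prod>B\<in>\<J>. \<Prod>B) = \<Prod>(\<Union>\<J>)"
      using prod.Union_disjoint[of \<J> "\<lambda>x. x"] fin disj empty(2)
      by (metis (no_types, lifting) comp_apply disjnt_def pairwise_def prod.cong subset_iff)
    moreover have "algebraic_int (a * \<Prod>(\<Union>\<J>))" using empty by (intro int) auto
    ultimately show ?case by (simp add: algint_poly_def coeff_pCons split: nat.split)
  next
    case (insert B \<I>)
    have finJ: "finite \<J>" using insert.prems fin(1) finite_subset by blast
    let ?P = "\<Prod>B\<in>\<I>. [:- \<Prod>B, 1:]" and ?c = "a * (\<Prod>B\<in>\<J>. \<Prod>B)"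
    have "algint_poly (smult ?c ?P)" using insert by auto
    then have X: "algint_poly (pCons 0 (smult ?c ?P))"
      by (auto simp: algint_poly_def coeff_pCons split: nat.split)
    have "algint_poly (smult (a * (\<Prod>B\<in>insert B \<J>. \<Prod>B)) ?P)"
      using insert by (intro insert.IH) auto
    moreover have "(\<Prod>B\<in>insert B \<J>. \<Prod>B) = \<Prod>B * (\<Prod>B\<in>\<J>. \<Prod>B)"
      using insert finJ by (intro prod.insert) auto
    ultimately have Y: "algint_poly (smult (\<Prod>B) (smult ?c ?P))" by (simp add: mult_ac)
    have "smult ?c (\<Prod>B\<in>insert B \<I>. [:- \<Prod>B, 1:]) = pCons 0 (smult ?c ?P) - smult (\<Prod>B) (smult ?c ?P)"
      using insert.hyps by (simp add: smult_diff_right mult_ac)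
    then show ?case using algint_poly_diff[OF X Y] by simp
  qed
  from this[OF fin(1) order.refl, of "{}"] show ?thesis by simp
qed

section \<open>The Galois group over the field generated by the conjugates of \<alpha>\<close>

definition conj_stabilizer :: "complex \<Rightarrow> (complex \<Rightarrow> complex) set" where
  "conj_stabilizer \<alpha> = {\<sigma> \<in> alg_auts. \<forall>c\<in>orbit alg_auts \<alpha>. \<sigma> c = c}"

lemma conj_stabilizer_subset: "conj_stabilizer \<alpha> \<subseteq> alg_auts"
  by (auto simp: conj_stabilizer_def)

lemma aut_group_conj_stabilizer: "aut_group (conj_stabilizer \<alpha>)"
  unfolding aut_group_def
proof (intro conjI ballI)
  show "inv_into UNIV \<sigma> \<in> conj_stabilizer \<alpha>" if "\<sigma> \<in> conj_stabilizer \<alpha>" for \<sigma>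
  proof -
    have s: "\<sigma> \<in> alg_auts" "\<forall>c\<in>orbit alg_auts \<alpha>. \<sigma> c = c" using that by (auto simp: conj_stabilizer_def)
    then have "\<forall>c\<in>orbit alg_auts \<alpha>. inv_into UNIV \<sigma> c = c" using inv_alg_aut(1)[OF s(1)] by metis
    then show ?thesis using alg_auts_inv[OF s(1)] by (simp add: conj_stabilizer_def)
  qed
qed (auto simp: conj_stabilizer_def alg_auts_id alg_auts_comp)

lemmas orbit_alg_auts_closed = orbit_closed[OF aut_group_alg_auts]

text \<open>The inverse of \<sigma> moves a conjugate of \<alpha> to another one, which \<tau>
  fixes. For the stabilizer of \<alpha> alone this would fail in general.\<close>

lemma conj_stabilizer_normal:
  assumes s: "\<sigma> \<in> alg_auts" and t: "\<tau> \<in> conj_stabilizer \<alpha>"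
  shows "\<sigma> \<circ> \<tau> \<circ> inv_into UNIV \<sigma> \<in> conj_stabilizer \<alpha>"
proof -
  have "\<sigma> (\<tau> (inv_into UNIV \<sigma> c)) = c" if "c \<in> orbit alg_auts \<alpha>" for c
    using t orbit_alg_auts_closed[OF alg_auts_inv[OF s] that] inv_alg_aut(2)[OF s]
    by (simp add: conj_stabilizer_def)
  then show ?thesis
    using t s by (auto simp: conj_stabilizer_def alg_auts_comp alg_auts_inv)
qed

text \<open>A consequence of normality: \<sigma> permutes the orbits of the stabilizer, and with
  them the norms of these orbits.\<close>

lemma image_orbit_conj_stabilizer:
  assumes s: "\<sigma> \<in> alg_auts"
  shows "\<sigma> ` orbit (conj_stabilizer \<alpha>) x = orbit (conj_stabilizer \<alpha>) (\<sigma> x)"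
proof -
  let ?H = "conj_stabilizer \<alpha>"
  have sub: "\<sigma> ` orbit ?H x \<subseteq> orbit ?H (\<sigma> x)" if s: "\<sigma> \<in> alg_auts" for \<sigma> x
  proof
    fix y assume "y \<in> \<sigma> ` orbit ?H x"
    then obtain \<tau> where t: "\<tau> \<in> ?H" "y = \<sigma> (\<tau> x)" by (auto simp: orbit_def)
    then have "y = (\<sigma> \<circ> \<tau> \<circ> inv_into UNIV \<sigma>) (\<sigma> x)" using inv_alg_aut(1)[OF s] by simp
    then show "y \<in> orbit ?H (\<sigma> x)"
      unfolding orbit_def using conj_stabilizer_normal[OF s t(1)] by blast
  qed
  have "orbit ?H (\<sigma> x) \<subseteq> \<sigma> ` orbit ?H x"
  proof
    fix y assume "y \<in> orbit ?H (\<sigma> x)"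
    then have "inv_into UNIV \<sigma> y \<in> orbit ?H (inv_into UNIV \<sigma> (\<sigma> x))"
      using sub[OF alg_auts_inv[OF s], of "\<sigma> x"] by blast
    then have "inv_into UNIV \<sigma> y \<in> orbit ?H x" by (simp add: inv_alg_aut(1)[OF s])
    then show "y \<in> \<sigma> ` orbit ?H x" using inv_alg_aut(2)[OF s, of y] by (metis image_eqI)
  qed
  then show ?thesis using sub[OF s] by blast
qed

text \<open>The orbit of \<sigma> x depends only on the action of \<sigma> on the conjugates of
  \<alpha>, and n conjugates have n ^ n self-maps. The bound is independent of x.\<close>

lemma card_conj_stabilizer_orbits:
  assumes \<alpha>: "algebraic \<alpha>"
  shows "card (orbit (conj_stabilizer \<alpha>) ` orbit alg_auts x) \<le>
    card (orbit alg_auts \<alpha>) ^ card (orbit alg_auts \<alpha>)"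
proof -
  let ?C = "orbit alg_auts \<alpha>" and ?H = "conj_stabilizer \<alpha>"
  let ?\<B> = "orbit ?H ` orbit alg_auts x"
  have C: "finite ?C" by (rule finite_orbit[OF order.refl \<alpha>])
  have "\<forall>B\<in>?\<B>. \<exists>\<sigma>. \<sigma> \<in> alg_auts \<and> B = orbit ?H (\<sigma> x)" by (auto simp: orbit_def)
  then obtain s where s: "\<And>B. B \<in> ?\<B> \<Longrightarrow> s B \<in> alg_auts \<and> B = orbit ?H (s B x)" by metis
  have "card ?\<B> \<le> card (?C \<rightarrow>\<^sub>E ?C)"
  proof (rule card_inj_on_le)
    show "(\<lambda>B. restrict (s B) ?C) ` ?\<B> \<subseteq> ?C \<rightarrow>\<^sub>E ?C"
      using s orbit_alg_auts_closed by auto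
    show "finite (?C \<rightarrow>\<^sub>E ?C)" using C by (intro finite_PiE) auto
    show "inj_on (\<lambda>B. restrict (s B) ?C) ?\<B>"
    proof (rule inj_onI)
      fix A B assume AB: "A \<in> ?\<B>" "B \<in> ?\<B>" "restrict (s A) ?C = restrict (s B) ?C"
      have sA: "s A \<in> alg_auts" "A = orbit ?H (s A x)" and sB: "s B \<in> alg_auts" "B = orbit ?H (s B x)"
        using s AB by blast+
      have "inv_into UNIV (s A) (s B c) = c" if "c \<in> ?C" for c
        using fun_cong[OF AB(3), of c] that inv_alg_aut(1)[OF sA(1), of c] by simp
      then have "inv_into UNIV (s A) \<circ> s B \<in> ?H"
        using alg_auts_comp[OF alg_auts_inv[OF sA(1)] sB(1)] by (simp add: conj_stabilizer_def)
      then have "inv_into UNIV (s A) (s B x) \<in> orbit ?H x" using orbitI by fastforce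
      then have "s A (inv_into UNIV (s A) (s B x)) \<in> s A ` orbit ?H x" by blast
      then have "s B x \<in> orbit ?H (s A x)"
        by (simp add: inv_alg_aut(2)[OF sA(1)] image_orbit_conj_stabilizer[OF sA(1)])
      then show "A = B" using orbit_eq[OF aut_group_conj_stabilizer] sA(2) sB(2) by metis
    qed
  qed
  also have "\<dots> = card ?C ^ card ?C" using C by (simp add: card_funcsetE)
  finally show ?thesis .
qed

text \<open>h is a times the product of X - \<open>\<Prod>B\<close> over the orbits B into which the
  conjugates of x split. Its coefficients are rational because automorphisms permute these orbits,
  and algebraic integers because a times any product of distinct conjugates is one.\<close>

lemma relative_norm_poly:
  assumes \<alpha>: "algebraic \<alpha>" and x: "algebraic x"
  obtains h :: "int poly" where "h \<noteq> 0"
    "degree h \<le> card (orbit alg_auts \<alpha>) ^ card (orbit alg_auts \<alpha>)"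
    "poly_mahler (map_poly of_int h) \<le> log_mahler x"
    "poly (map_poly of_int h) (\<Prod>(orbit (conj_stabilizer \<alpha>) x)) = 0"
proof -
  let ?H = "conj_stabilizer \<alpha>" and ?O = "orbit alg_auts x"
  define \<B> where "\<B> = orbit ?H ` ?O"
  define a where "a = complex_of_int (lead_coeff (min_int_poly x))"
  have a0: "a \<noteq> 0" using min_int_poly_nonzero[OF x] by (simp add: a_def)
  have O: "finite ?O" by (rule finite_orbit[OF order.refl x])
  have fin: "finite \<B>" using O by (simp add: \<B>_def)
  have B_alg: "algebraic w" if "B \<in> \<B>" "w \<in> B" for B w
    using that x by (auto simp: \<B>_def intro: orbit_algebraic[OF conj_stabilizer_subset orbit_algebraic[OF order.refl]])
  have finB: "finite B" if "B \<in> \<B>" for B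
    using that x by (auto simp: \<B>_def intro: finite_orbit[OF conj_stabilizer_subset orbit_algebraic[OF order.refl]])
  have disj: "pairwise disjnt \<B>"
  proof (rule pairwiseI)
    fix A B assume AB: "A \<in> \<B>" "B \<in> \<B>" "A \<noteq> B"
    show "disjnt A B"
    proof (rule ccontr)
      assume "\<not> disjnt A B"
      then obtain w where "w \<in> A" "w \<in> B" by (auto simp: disjnt_def)
      then have "A = orbit ?H w" "B = orbit ?H w"
        using AB orbit_eq[OF aut_group_conj_stabilizer] by (auto simp: \<B>_def)
      then show False using AB by simp
    qed
  qed
  have un: "\<Union>\<B> = ?O"
  proof
    show "\<Union>\<B> \<subseteq> ?O"
      using orbit_alg_auts_closed conj_stabilizer_subset by (force simp: \<B>_def orbit_def[of ?H])
    show "?O \<subseteq> \<Union>\<B>" using orbit_self[OF aut_group_conj_stabilizer] by (auto simp: \<B>_def)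
  qed
  have "algint_poly (map_poly of_int (min_int_poly x))"
    by (auto simp: algint_poly_def intro: int_imp_algebraic_int)
  then have "algint_poly (smult a (\<Prod>w\<in>?O. [:- w, 1:]))"
    by (simp add: min_int_poly_eq_orbit_prod[OF x] a_def)
  then have algint: "algint_poly (smult a (\<Prod>B\<in>\<B>. [:- \<Prod>B, 1:]))"
    using algebraic_int_mult_prod_roots[OF O] un by (intro algint_poly_prod_norms fin finB disj) auto
  have rat: "coeff (\<Prod>B\<in>\<B>. [:- \<Prod>B, 1:]) n \<in> \<rat>" for n
  proof (rule invariant_prod_linear_rational)
    show "algebraic (\<Prod>B)" if "B \<in> \<B>" for B
      using algebraic_prod[of B "\<lambda>w. w"] B_alg[OF that] by simp
    fix \<sigma> assume s: "\<sigma> \<in> alg_auts"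
    have "(`) \<sigma> ` \<B> \<subseteq> \<B>"
      using orbit_alg_auts_closed[OF s] by (auto simp: \<B>_def image_orbit_conj_stabilizer[OF s])
    moreover have inj: "inj_on ((`) \<sigma>) \<B>"
      using alg_auts_inj[OF s] by (intro inj_onI) (simp add: inj_image_eq_iff)
    ultimately have "bij_betw ((`) \<sigma>) \<B> \<B>"
      using endo_inj_surj[OF fin] by (simp add: bij_betw_def)
    moreover have "\<sigma> (\<Prod>B) = \<Prod>(\<sigma> ` B)" if "B \<in> \<B>" for B
      using alg_auts_prod[OF s, of B "\<lambda>w. w"] B_alg[OF that]
        prod.reindex[OF inj_on_subset[OF alg_auts_inj[OF s]], of B "\<lambda>w. w"] by simp
    ultimately show "\<exists>\<pi>. bij_betw \<pi> \<B> \<B> \<and> (\<forall>B\<in>\<B>. \<sigma> (\<Prod>B) = \<Prod>(\<pi> B))" by blast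
  qed
  have "coeff (smult a (\<Prod>B\<in>\<B>. [:- \<Prod>B, 1:])) n \<in> \<int>" for n
  proof (rule rational_algebraic_int_is_int)
    show "algebraic_int (coeff (smult a (\<Prod>B\<in>\<B>. [:- \<Prod>B, 1:])) n)"
      using algint by (simp only: algint_poly_def)
    show "coeff (smult a (\<Prod>B\<in>\<B>. [:- \<Prod>B, 1:])) n \<in> \<rat>"
      using rat[of n] by (simp add: a_def)
  qed
  then obtain h where h: "smult a (\<Prod>B\<in>\<B>. [:- \<Prod>B, 1:]) = map_poly of_int h"
    by (rule intpolyE)
  show ?thesis
  proof (rule that)
    show h0: "h \<noteq> 0" using h a0 fin by auto
    have "degree h = degree (smult a (\<Prod>B\<in>\<B>. [:- \<Prod>B, 1:]))" unfolding h by simp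
    also have "\<dots> = card \<B>" using a0 by (simp add: degree_prod_sum_eq)
    finally show "degree h \<le> card (orbit alg_auts \<alpha>) ^ card (orbit alg_auts \<alpha>)"
      using card_conj_stabilizer_orbits[OF \<alpha>, of x] by (simp add: \<B>_def)
    have "poly_mahler (map_poly of_int h) = ln (cmod a) + (\<Sum>B\<in>\<B>. ln (max 1 (cmod (\<Prod>B))))"
      unfolding h[symmetric] by (rule poly_mahler_prod_linear[OF a0 fin])
    also have "\<dots> \<le> ln (cmod a) + (\<Sum>B\<in>\<B>. \<Sum>w\<in>B. ln (max 1 (cmod w)))"
      by (intro add_left_mono sum_mono ln_max_prod_le finB)
    also have "(\<Sum>B\<in>\<B>. \<Sum>w\<in>B. ln (max 1 (cmod w))) = (\<Sum>w\<in>\<Union>\<B>. ln (max 1 (cmod w)))"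
      using sum.Union_disjoint[of \<B> "\<lambda>w. ln (max 1 (cmod w))"] finB disj
      by (auto simp: pairwise_def disjnt_def)
    also have "ln (cmod a) + \<dots> = log_mahler x"
      unfolding un log_mahler_eq_orbit_sum[OF x] a_def ..
    finally show "poly_mahler (map_poly of_int h) \<le> log_mahler x" .
    have "orbit ?H x \<in> \<B>" using orbit_self[OF aut_group_alg_auts, of x] by (simp add: \<B>_def)
    then show "poly (map_poly of_int h) (\<Prod>(orbit ?H x)) = 0"
      unfolding h[symmetric] using fin by (auto simp: poly_prod prod_zero_iff)
  qed
qed

text \<open>H may be infinite, so its finitely many restrictions to X take its place. Those sending
  x to y are equally many for all y in the orbit, since composition with a suitable \<tau> injects
  one such set into another; this number is \<open>e x\<close>.\<close>

lemma orbit_stabilizer_prod: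
  assumes H: "aut_group H" and fin: "finite X" and inv: "\<forall>\<sigma>\<in>H. \<forall>y\<in>X. \<sigma> y \<in> X"
  defines "R \<equiv> (\<lambda>\<sigma>. restrict \<sigma> X) ` H"
  shows "finite R" "R \<noteq> {}"
    "\<exists>e. \<forall>x\<in>X. finite (orbit H x) \<longrightarrow> card R = card (orbit H x) * e x \<and> (\<Prod>\<rho>\<in>R. \<rho> x) = (\<Prod>(orbit H x)) ^ e x"
proof -
  have R_sub: "R \<subseteq> X \<rightarrow>\<^sub>E X" using inv by (auto simp: R_def)
  then show finR: "finite R" by (rule finite_subset) (intro finite_PiE fin)
  show "R \<noteq> {}" using H by (auto simp: R_def aut_group_def)
  define F where "F = (\<lambda>x y. {\<rho> \<in> R. \<rho> x = y})"
  have le: "card (F x y) \<le> card (F x z)" if x: "x \<in> X" and y: "y \<in> orbit H x" and z: "z \<in> orbit H x" for x y z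
  proof -
    have "z \<in> orbit H y" using orbit_eq[OF H y] z by simp
    then obtain \<tau> where t: "\<tau> \<in> H" "z = \<tau> y" by (elim orbitE)
    have inj: "inj \<tau>" using t H alg_auts_inj by (auto simp: aut_group_def)
    show ?thesis
    proof (rule card_inj_on_le)
      show "inj_on (\<lambda>\<rho>. restrict (\<tau> \<circ> \<rho>) X) (F x y)"
      proof (rule inj_onI)
        fix \<rho> \<rho>' assume A: "\<rho> \<in> F x y" "\<rho>' \<in> F x y" "restrict (\<tau> \<circ> \<rho>) X = restrict (\<tau> \<circ> \<rho>') X"
        have "\<rho> w = \<rho>' w" if "w \<in> X" for w
          using fun_cong[OF A(3), of w] that inj by (simp add: inj_eq)
        moreover have "\<rho> \<in> extensional X" "\<rho>' \<in> extensional X"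
          using A R_sub by (auto simp: F_def PiE_def)
        ultimately show "\<rho> = \<rho>'" by (intro extensionalityI)
      qed
      show "(\<lambda>\<rho>. restrict (\<tau> \<circ> \<rho>) X) ` F x y \<subseteq> F x z"
      proof
        fix f assume "f \<in> (\<lambda>\<rho>. restrict (\<tau> \<circ> \<rho>) X) ` F x y"
        then obtain \<sigma> where f: "\<sigma> \<in> H" "f = restrict (\<tau> \<circ> restrict \<sigma> X) X" "restrict \<sigma> X x = y"
          by (auto simp: F_def R_def)
        have "f = restrict (\<tau> \<circ> \<sigma>) X" unfolding f(2) by (auto simp: restrict_def)
        moreover have "\<tau> \<circ> \<sigma> \<in> H" using H t f(1) by (simp add: aut_group_def)
        ultimately show "f \<in> F x z" using f(3) x t(2) by (auto simp: F_def R_def)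
      qed
      show "finite (F x z)" using finR by (simp add: F_def)
    qed
  qed
  show "\<exists>e. \<forall>x\<in>X. finite (orbit H x) \<longrightarrow> card R = card (orbit H x) * e x \<and> (\<Prod>\<rho>\<in>R. \<rho> x) = (\<Prod>(orbit H x)) ^ e x"
  proof (intro exI ballI impI)
    fix x assume x: "x \<in> X" and orb: "finite (orbit H x)"
    have card: "card (F x y) = card (F x x)" if "y \<in> orbit H x" for y
      using le[OF x that orbit_self[OF H]] le[OF x orbit_self[OF H] that] by simp
    have img: "(\<lambda>\<rho>. \<rho> x) ` R \<subseteq> orbit H x" using x by (auto simp: R_def orbit_def)
    have "(\<Sum>y\<in>orbit H x. card (F x y)) = card R"
      using sum.group[OF finR orb img, of "\<lambda>_. 1 :: nat"] by (simp add: F_def)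
    then have "card R = card (orbit H x) * card (F x x)" by (simp add: card)
    moreover have "(\<Prod>\<rho>\<in>R. \<rho> x) = (\<Prod>y\<in>orbit H x. \<Prod>\<rho>\<in>F x y. \<rho> x)"
      using prod.group[OF finR orb img, of "\<lambda>\<rho>. \<rho> x"] by (simp add: F_def)
    then have "(\<Prod>\<rho>\<in>R. \<rho> x) = (\<Prod>y\<in>orbit H x. y ^ card (F x x))"
      by (simp add: F_def card[unfolded F_def])
    ultimately show "card R = card (orbit H x) * card (F x x) \<and> (\<Prod>\<rho>\<in>R. \<rho> x) = (\<Prod>(orbit H x)) ^ card (F x x)"
      by (simp add: prod_power_distrib)
  qed
qed

lemma alg_auts_prod_list:
  assumes s: "\<sigma> \<in> alg_auts"
  shows "(\<forall>x\<in>set xs. algebraic x) \<Longrightarrow> algebraic (prod_list xs) \<and> \<sigma> (prod_list xs) = prod_list (map \<sigma> xs)"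
  by (induction xs) (auto simp: alg_auts_1[OF s] alg_auts_mult[OF s] algebraic_mult rat_imp_algebraic)

lemma prod_prod_list_swap:
  fixes f :: "'i \<Rightarrow> 'a \<Rightarrow> 'b :: comm_monoid_mult"
  shows "(\<Prod>i\<in>I. prod_list (map (f i) xs)) = prod_list (map (\<lambda>x. \<Prod>i\<in>I. f i x) xs)"
  by (induction xs) (simp_all add: prod.distrib)

lemma prod_list_power:
  fixes f :: "'a \<Rightarrow> 'b :: comm_monoid_mult"
  shows "prod_list (map f xs) ^ n = prod_list (map (\<lambda>x. f x ^ n) xs)"
  by (induction xs) (simp_all add: power_mult_distrib)

text \<open>Every factor \<open>x\<close> is replaced by a root \<open>b x\<close> of its relative norm over the field generated by
  the conjugates of \<open>\<alpha>\<close>; the product of these roots is \<open>\<alpha>\<close> up to a root of unity.\<close>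

lemma factorization_replacement:
  assumes \<alpha>: "algebraic \<alpha>" "\<alpha> \<noteq> 0" and as: "as \<in> factorizations \<alpha>"
  obtains b v z where "z # map b as \<in> factorizations \<alpha>" "log_mahler z = 0"
    "\<forall>x\<in>set as. log_mahler (b x) \<le> v x \<and> v x \<le> log_mahler x \<and>
       v x \<in> int_poly_measures (card (orbit alg_auts \<alpha>) ^ card (orbit alg_auts \<alpha>))"
proof -
  let ?H = "conj_stabilizer \<alpha>" and ?k = "card (orbit alg_auts \<alpha>) ^ card (orbit alg_auts \<alpha>)"
  note grp = aut_group_conj_stabilizer[of \<alpha>]
  have alg: "algebraic x" if "x \<in> set as" for x
    using as that by (auto simp: factorizations_def)
  have prod: "prod_list as = \<alpha>" using as by (simp add: factorizations_def)
  have orb: "finite (orbit ?H x)" "card (orbit ?H x) > 0" if "x \<in> set as" for x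
    using finite_orbit[OF conj_stabilizer_subset alg[OF that], of \<alpha>] orbit_self[OF grp, of x]
    by (auto simp: card_gt_0_iff)
  \<comment> \<open>v will be the measure of the norm polynomial, not of b, whose degree is not
    bounded in terms of \<alpha>.\<close>
  have "\<exists>b v. log_mahler b \<le> v \<and> v \<le> log_mahler x \<and> v \<in> int_poly_measures ?k \<and>
      b ^ card (orbit ?H x) = \<Prod>(orbit ?H x) \<and> algebraic b" if x: "x \<in> set as" for x
  proof -
    obtain h :: "int poly" where h: "h \<noteq> 0" "degree h \<le> ?k"
      "poly_mahler (map_poly of_int h) \<le> log_mahler x" "poly (map_poly of_int h) (\<Prod>(orbit ?H x)) = 0"
      by (rule relative_norm_poly[OF \<alpha>(1) alg[OF x]])
    obtain b where b: "\<Prod>(orbit ?H x) = b ^ card (orbit ?H x)"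
      by (rule exists_complex_root[of "card (orbit ?H x)" "\<Prod>(orbit ?H x)"]) (use orb[OF x] in auto)
    have "log_mahler b \<le> poly_mahler (map_poly of_int h)" "algebraic b"
      using log_mahler_radical_le[OF h(1) h(4)[unfolded b] orb(2)[OF x]] by auto
    moreover have "poly_mahler (map_poly of_int h) \<in> int_poly_measures ?k"
      using h by (auto simp: int_poly_measures_def)
    ultimately show ?thesis using h(3) b by metis
  qed
  then obtain b v where bv: "\<And>x. x \<in> set as \<Longrightarrow> log_mahler (b x) \<le> v x \<and> v x \<le> log_mahler x \<and>
      v x \<in> int_poly_measures ?k \<and> b x ^ card (orbit ?H x) = \<Prod>(orbit ?H x) \<and> algebraic (b x)"
    by metis
  define X where "X = (\<Union>x\<in>set as. orbit ?H x)"
  have finX: "finite X" using orb by (auto simp: X_def)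
  have sub: "set as \<subseteq> X" using orbit_self[OF grp] by (auto simp: X_def)
  have inv: "\<forall>\<sigma>\<in>?H. \<forall>y\<in>X. \<sigma> y \<in> X"
    using orbit_closed[OF grp] by (auto simp: X_def)
  define R where "R = (\<lambda>\<sigma>. restrict \<sigma> X) ` ?H"
  have R: "finite R" "R \<noteq> {}" and "\<exists>e. \<forall>x\<in>X. finite (orbit ?H x) \<longrightarrow>
      card R = card (orbit ?H x) * e x \<and> (\<Prod>\<rho>\<in>R. \<rho> x) = (\<Prod>(orbit ?H x)) ^ e x"
    using orbit_stabilizer_prod[OF grp finX inv] unfolding R_def by blast+
  then obtain e where e: "\<And>x. x \<in> X \<Longrightarrow> finite (orbit ?H x) \<Longrightarrow>
      card R = card (orbit ?H x) * e x \<and> (\<Prod>\<rho>\<in>R. \<rho> x) = (\<Prod>(orbit ?H x)) ^ e x"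
    by blast
  \<comment> \<open>A multiple of every orbit size: each \<open>b x\<close> raised to this power
    becomes the product of all \<open>\<rho> x\<close>, with the same index set \<open>R\<close> for
    all factors.\<close>
  define L where "L = card R"
  have L: "L > 0" using R by (simp add: L_def card_gt_0_iff)
  have bL: "b x ^ L = (\<Prod>\<rho>\<in>R. \<rho> x)" if x: "x \<in> set as" for x
    using e[of x] sub x orb[OF x] bv[OF x] by (simp add: L_def power_mult subset_iff)
  \<comment> \<open>Each restriction comes from an automorphism fixing \<alpha>, so it carries the
    factorization to another one of \<alpha>.\<close>
  have "prod_list (map \<rho> as) = \<alpha>" if \<rho>: "\<rho> \<in> R" for \<rho>
  proof -
    obtain \<sigma> where s: "\<sigma> \<in> ?H" "\<rho> = restrict \<sigma> X" using \<rho> by (auto simp: R_def)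
    then have sa: "\<sigma> \<in> alg_auts" "\<sigma> \<alpha> = \<alpha>"
      using orbit_self[OF aut_group_alg_auts, of \<alpha>] by (auto simp: conj_stabilizer_def)
    have map_eq: "map \<rho> as = map \<sigma> as" using sub s(2) by auto
    show ?thesis unfolding map_eq using alg_auts_prod_list[OF sa(1), of as] alg prod sa(2) by simp
  qed
  then have "\<alpha> ^ L = (\<Prod>\<rho>\<in>R. prod_list (map \<rho> as))" by (simp add: L_def)
  also have "\<dots> = prod_list (map (\<lambda>x. \<Prod>\<rho>\<in>R. \<rho> x) as)" by (rule prod_prod_list_swap)
  also have "\<dots> = prod_list (map (\<lambda>x. b x ^ L) as)" using bL by (auto cong: map_cong)
  also have "\<dots> = prod_list (map b as) ^ L" by (rule prod_list_power[symmetric])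
  finally have pow: "\<alpha> ^ L = prod_list (map b as) ^ L" .
  have b0: "prod_list (map b as) \<noteq> 0" using pow \<alpha>(2) L by (metis power_eq_0_iff zero_power)
  define z where "z = \<alpha> / prod_list (map b as)"
  have zL: "z ^ L = 1" using pow b0 \<alpha>(2) by (simp add: z_def power_divide)
  have z: "log_mahler z = 0" "algebraic z" using log_mahler_root_of_unity[OF zL L] by auto
  have z0: "z \<noteq> 0" using zL L by (auto simp: power_0_left)
  have "z # map b as \<in> factorizations \<alpha>"
    using z z0 b0 bv by (auto simp: factorizations_def z_def prod_list_zero_iff)
  then show ?thesis using that[of z b v] z bv by blast
qed

section \<open>Metric Mahler measures as finite minima\<close>

definition power_norm :: "real \<Rightarrow> real list \<Rightarrow> real" where
  "power_norm t us = (\<Sum>u\<leftarrow>us. u powr t) powr (1 / t)"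

lemma metric_mahler_eq_INF:
  "metric_mahler t \<alpha> = (INF as\<in>factorizations \<alpha>. power_norm t (map log_mahler as))"
  by (simp add: metric_mahler_def power_norm_def o_def)

lemma sum_list_powr_nonneg: "0 \<le> (\<Sum>u\<leftarrow>us. (f u :: real) powr t)"
  by (rule sum_list_nonneg) auto

lemma power_norm_mono:
  assumes "t > 0" "\<And>x. x \<in> set xs \<Longrightarrow> 0 \<le> f x \<and> f x \<le> g x"
  shows "power_norm t (map f xs) \<le> power_norm t (map g xs)"
proof -
  have "(\<Sum>x\<leftarrow>xs. f x powr t) \<le> (\<Sum>x\<leftarrow>xs. g x powr t)"
    by (rule sum_list_mono) (use assms in \<open>auto intro!: powr_mono2\<close>)
  then show ?thesis
    unfolding power_norm_def using assms(1) by (intro powr_mono2) (auto simp: o_def sum_list_powr_nonneg)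
qed

text \<open>\<open>0 powr t\<close> is 0 for every t, so factors of measure 0 leave no
  trace.\<close>

lemma power_norm_filter_nonzero: "power_norm t (filter (\<lambda>u. u \<noteq> 0) us) = power_norm t us"
proof -
  have "(\<Sum>u\<leftarrow>filter (\<lambda>u. u \<noteq> 0) us. u powr t) = (\<Sum>u\<leftarrow>us. u powr t)"
    by (induction us) auto
  then show ?thesis by (simp add: power_norm_def)
qed

lemma power_norm_single: "t > 0 \<Longrightarrow> 0 \<le> u \<Longrightarrow> power_norm t [u] = u"
  by (simp add: power_norm_def powr_powr)

lemma power_norm_nonneg: "0 \<le> power_norm t us"
  by (simp add: power_norm_def)

lemma power_norm_le_iff:
  assumes "t > 0" "0 \<le> B"
  shows "power_norm t us \<le> B \<longleftrightarrow> (\<Sum>u\<leftarrow>us. u powr t) \<le> B powr t"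
proof -
  let ?S = "\<Sum>u\<leftarrow>us. u powr t"
  have S: "0 \<le> ?S" by (rule sum_list_powr_nonneg)
  have eq: "(?S powr (1 / t)) powr t = ?S" "(B powr t) powr (1 / t) = B"
    using assms S by (simp_all add: powr_powr)
  show ?thesis
    unfolding power_norm_def
    using powr_mono2[of t "?S powr (1 / t)" B] powr_mono2[of "1 / t" ?S "B powr t"] assms S eq by auto
qed

lemma finite_positive_lower_bound:
  fixes V :: "real set"
  assumes "finite V" "\<And>v. v \<in> V \<Longrightarrow> 0 < v"
  obtains \<delta> where "\<delta> > 0" "\<And>v. v \<in> V \<Longrightarrow> \<delta> \<le> v"
  \<comment> \<open>The element 1 keeps \<open>Min\<close> meaningful for empty V.\<close>
  using assms by (intro that[of "Min (insert 1 V)"]) auto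

text \<open>n entries of size at least \<delta> give n * \<delta> ^ t <= B ^ t. The maximum with 1
  makes the resulting bound nondecreasing in t, so that the exponent b serves for all t up to
  b.\<close>

lemma power_norm_bounded_entries:
  assumes t: "t > 0" "t \<le> b" and B: "0 \<le> B" "power_norm t us \<le> B"
    and \<delta>: "\<delta> > 0" "\<And>u. u \<in> set us \<Longrightarrow> \<delta> \<le> u"
  shows "\<And>u. u \<in> set us \<Longrightarrow> u \<le> B" "real (length us) \<le> max 1 (B / \<delta>) powr b"
proof -
  have le: "(\<Sum>u\<leftarrow>us. u powr t) \<le> B powr t" using B power_norm_le_iff t(1) by blast
  show "u \<le> B" if "u \<in> set us" for u
  proof -
    have "u powr t \<le> (\<Sum>u\<leftarrow>us. u powr t)"
      using that by (intro member_le_sum_list) auto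
    then have "u powr t \<le> B powr t" using le by simp
    then have "power_norm t [u] \<le> B" using power_norm_le_iff[OF t(1) B(1), of "[u]"] by simp
    then show ?thesis using power_norm_single[OF t(1), of u] \<delta>(1) \<delta>(2)[OF that] by simp
  qed
  have "real (length us) * \<delta> powr t = (\<Sum>u\<leftarrow>us. \<delta> powr t)" by (simp add: sum_list_triv)
  also have "\<dots> \<le> (\<Sum>u\<leftarrow>us. u powr t)"
    using t \<delta> by (intro sum_list_mono powr_mono2) auto
  finally have "real (length us) \<le> B powr t / \<delta> powr t"
    using le \<delta>(1) by (simp add: field_simps)
  also have "\<dots> = (B / \<delta>) powr t" using B \<delta>(1) by (simp add: powr_divide)
  also have "\<dots> \<le> max 1 (B / \<delta>) powr t" using t B \<delta>(1) by (intro powr_mono2) auto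
  also have "\<dots> \<le> max 1 (B / \<delta>) powr b" using t by (intro powr_mono) auto
  finally show "real (length us) \<le> max 1 (B / \<delta>) powr b" .
qed

text \<open>One T serves all t up to b. The bound b limits the lengths of its members, since the
  estimate (B / \<delta>) ^ t may grow with t.\<close>

lemma metric_mahler_eq_Min:
  assumes \<alpha>: "algebraic \<alpha>" "\<alpha> \<noteq> 0"
  obtains T where "finite T" "T \<noteq> {}" "\<forall>us\<in>T. \<forall>u\<in>set us. u > 0"
    "\<forall>t. 0 < t \<and> t \<le> b \<longrightarrow> metric_mahler t \<alpha> = Min (power_norm t ` T)"
proof (cases "b > 0")
  case False
  \<comment> \<open>The claim about t is vacuous here.\<close>
  show ?thesis by (rule that[of "{[]}"]) (use False in auto)
next
  case b: True
  define D where "D = int_poly_measures (card (orbit alg_auts \<alpha>) ^ card (orbit alg_auts \<alpha>))"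
  define B where "B = log_mahler \<alpha>"
  \<comment> \<open>Each vector in W lies above some factorization for all t at once, and by
    \<open>W_ex\<close> each factorization lies above a vector in W; so both have the same
    infimum.\<close>
  define W where "W = {vs. set vs \<subseteq> D \<and>
    (\<exists>bs\<in>factorizations \<alpha>. \<forall>t>0. power_norm t (map log_mahler bs) \<le> power_norm t vs)}"
  have B: "0 \<le> B" using log_mahler_nonneg[OF \<alpha>(1)] by (simp add: B_def)
  have W_ex: "\<exists>vs\<in>W. \<forall>t>0. power_norm t vs \<le> power_norm t (map log_mahler as)"
    if as: "as \<in> factorizations \<alpha>" for as
  proof -
    obtain f v z where fv: "z # map f as \<in> factorizations \<alpha>" "log_mahler z = 0"
      "\<forall>x\<in>set as. log_mahler (f x) \<le> v x \<and> v x \<le> log_mahler x \<and> v x \<in> D"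
      unfolding D_def by (rule factorization_replacement[OF \<alpha> as])
    have nonneg: "0 \<le> log_mahler (f x)" if "x \<in> set as" for x
      using fv(1) that by (intro log_mahler_nonneg) (auto simp: factorizations_def)
    have "power_norm t (map log_mahler (z # map f as)) = power_norm t (map (\<lambda>x. log_mahler (f x)) as)" for t
      using fv(2) by (simp add: power_norm_def o_def)
    moreover have "power_norm t (map (\<lambda>x. log_mahler (f x)) as) \<le> power_norm t (map v as)" if "t > 0" for t
      using fv(3) nonneg that by (intro power_norm_mono) auto
    ultimately have "map v as \<in> W"
      using fv(1,3) unfolding W_def by (auto intro!: bexI[of _ "z # map f as"])
    moreover have "power_norm t (map v as) \<le> power_norm t (map log_mahler as)" if "t > 0" for t
      using fv(3) nonneg that by (intro power_norm_mono) force+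
    ultimately show ?thesis by blast
  qed
  \<comment> \<open>Northcott's theorem makes V finite, which gives a positive lower bound \<delta>
    common to all factorizations.\<close>
  define V where "V = {v \<in> D. v \<le> B \<and> 0 < v}"
  have "finite V"
    by (rule finite_subset[OF _ finite_int_poly_measures_le]) (auto simp: V_def D_def)
  then obtain \<delta> where \<delta>: "\<delta> > 0" "\<And>v. v \<in> V \<Longrightarrow> \<delta> \<le> v"
    by (rule finite_positive_lower_bound) (auto simp: V_def)
  define n where "n = nat \<lfloor>max 1 (B / \<delta>) powr b\<rfloor>"
  define T where "T = {us \<in> filter (\<lambda>u. u \<noteq> 0) ` W. set us \<subseteq> V \<and> length us \<le> n}"
  have T_I: "filter (\<lambda>u. u \<noteq> 0) vs \<in> T" if vs: "vs \<in> W" "power_norm t vs \<le> B" and t: "0 < t" "t \<le> b" for vs t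
  proof -
    let ?us = "filter (\<lambda>u. u \<noteq> 0) vs"
    have pos: "0 < u \<and> u \<in> D" if "u \<in> set ?us" for u
      using that vs(1) int_poly_measures_nonneg by (force simp: W_def D_def)
    have us: "power_norm t ?us \<le> B" using vs(2) by (simp add: power_norm_filter_nonzero)
    \<comment> \<open>This bound depends on the vector but suffices to show that its entries are at
      most B; only then do they lie in V, where \<delta> applies.\<close>
    obtain \<epsilon> where \<epsilon>: "\<epsilon> > 0" "\<And>u. u \<in> set ?us \<Longrightarrow> \<epsilon> \<le> u"
      by (rule finite_positive_lower_bound[of "set ?us"]) (use pos in auto)
    have "u \<le> B" if "u \<in> set ?us" for u
      by (rule power_norm_bounded_entries(1)[OF t B us \<epsilon> that])
    then have V: "set ?us \<subseteq> V" using pos by (auto simp: V_def)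
    have "real (length ?us) \<le> max 1 (B / \<delta>) powr b"
      by (rule power_norm_bounded_entries(2)[OF t B us \<delta>(1)]) (use \<delta>(2) V in blast)
    then have "length ?us \<le> n" unfolding n_def by (simp add: le_nat_floor)
    then show ?thesis using V vs(1) by (auto simp: T_def)
  qed
  \<comment> \<open>The trivial factorization supplies one vector of norm at most B for every t. It
    makes T nonempty and beats every vector of norm above B.\<close>
  have "[\<alpha>] \<in> factorizations \<alpha>" using \<alpha> by (simp add: factorizations_def)
  then obtain v0 where v0: "v0 \<in> W" "\<forall>t>0. power_norm t v0 \<le> power_norm t [B]"
    using W_ex[of "[\<alpha>]"] by (auto simp: B_def)
  have v0B: "power_norm t v0 \<le> B" if "t > 0" for t
    using v0(2) power_norm_single[OF that B] that by auto
  define u0 where "u0 = filter (\<lambda>u. u \<noteq> 0) v0"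
  have u0: "u0 \<in> T" using T_I[OF v0(1) v0B] b by (auto simp: u0_def)
  have finT: "finite T"
    by (rule finite_subset[OF _ finite_lists_length_le[OF \<open>finite V\<close>, of n]]) (auto simp: T_def)
  have Min_eq: "metric_mahler t \<alpha> = Min (power_norm t ` T)" if t: "0 < t" "t \<le> b" for t
  proof (rule antisym)
    show "Min (power_norm t ` T) \<le> metric_mahler t \<alpha>"
      unfolding metric_mahler_eq_INF
    proof (rule cINF_greatest)
      show "factorizations \<alpha> \<noteq> {}" using \<open>[\<alpha>] \<in> factorizations \<alpha>\<close> by blast
      fix as assume "as \<in> factorizations \<alpha>"
      then obtain vs where vs: "vs \<in> W" "power_norm t vs \<le> power_norm t (map log_mahler as)"
        using W_ex t(1) by blast
      show "Min (power_norm t ` T) \<le> power_norm t (map log_mahler as)"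
      proof (cases "power_norm t vs \<le> B")
        case True
        have "Min (power_norm t ` T) \<le> power_norm t (filter (\<lambda>u. u \<noteq> 0) vs)"
          using T_I[OF vs(1) True t] finT by (intro Min_le) auto
        then show ?thesis using vs(2) by (simp add: power_norm_filter_nonzero)
      next
        case False
        have "Min (power_norm t ` T) \<le> power_norm t u0" using u0 finT by (intro Min_le) auto
        also have "\<dots> \<le> B" using v0B[OF t(1)] by (simp add: u0_def power_norm_filter_nonzero)
        finally show ?thesis using False vs(2) by simp
      qed
    qed
    show "metric_mahler t \<alpha> \<le> Min (power_norm t ` T)"
    proof (rule Min.boundedI)
      fix y assume "y \<in> power_norm t ` T"
      then obtain vs where vs: "vs \<in> W" "y = power_norm t vs"
        by (auto simp: T_def power_norm_filter_nonzero)
      then obtain bs where "bs \<in> factorizations \<alpha>" "power_norm t (map log_mahler bs) \<le> y"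
        using t(1) by (auto simp: W_def)
      moreover have "bdd_below ((\<lambda>as. power_norm t (map log_mahler as)) ` factorizations \<alpha>)"
        by (rule bdd_belowI[of _ 0]) (auto simp: power_norm_nonneg)
      ultimately show "metric_mahler t \<alpha> \<le> y"
        unfolding metric_mahler_eq_INF by (meson cINF_lower order_trans)
    qed (use finT u0 in auto)
  qed
  show ?thesis
    by (rule that[OF finT]) (use u0 Min_eq in \<open>auto simp: T_def V_def\<close>)
qed

section \<open>Holomorphic extension and smoothness\<close>

text \<open>Each u ^ t becomes exp (z * ln u), and the outer power uses the principal logarithm, on
  the set where the sum avoids the nonpositive real axis. For positive real z the sum is
  positive.\<close>

lemma power_norm_holomorphic_extension:
  assumes pos: "\<forall>u\<in>set us. u > 0"
  obtains F A where "open A" "F holomorphic_on A"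
    "\<forall>t>0. complex_of_real t \<in> A \<and> F (of_real t) = of_real (power_norm t us)"
proof (cases "us = []")
  case True
  \<comment> \<open>For the empty list the sum is identically 0 and has no logarithm.\<close>
  show ?thesis
    by (rule that[of UNIV "\<lambda>_. 0"]) (use True in \<open>auto simp: power_norm_def\<close>)
next
  case False
  define S where "S = (\<lambda>z. \<Sum>i<length us. exp (z * complex_of_real (ln (us ! i))))"
  have S_hol: "S holomorphic_on X" for X unfolding S_def by (intro holomorphic_intros)
  have S_real: "S (of_real t) = of_real (\<Sum>u\<leftarrow>us. u powr t)" for t
  proof -
    have "exp (complex_of_real t * of_real (ln (us ! i))) = of_real (us ! i powr t)" if "i < length us" for i
      using bspec[OF pos nth_mem[OF that]] by (simp add: powr_def flip: of_real_mult exp_of_real)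
    then show ?thesis by (simp add: S_def sum_list_sum_nth atLeast0LessThan)
  qed
  have sum_pos: "(\<Sum>u\<leftarrow>us. u powr t) > 0" for t
    using False pos by (cases us) (auto intro!: add_pos_nonneg sum_list_powr_nonneg)
  define A where "A = {z. z \<noteq> 0} \<inter> S -` (- \<real>\<^sub>\<le>\<^sub>0)"
  show ?thesis
  proof (rule that[of A "\<lambda>z. exp (Ln (S z) / z)"])
    have "open (S -` (- \<real>\<^sub>\<le>\<^sub>0))"
      by (intro open_vimage holomorphic_on_imp_continuous_on S_hol)
        (simp add: closed_nonpos_Reals_complex open_Compl)
    moreover have "open {z :: complex. z \<noteq> 0}" by (intro open_Collect_neq continuous_intros)
    ultimately show "open A" unfolding A_def by blast
    show "(\<lambda>z. exp (Ln (S z) / z)) holomorphic_on A"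
      unfolding A_def by (intro holomorphic_intros S_hol) auto
    show "\<forall>t>0. complex_of_real t \<in> A \<and> exp (Ln (S (of_real t)) / of_real t) = of_real (power_norm t us)"
    proof (intro allI impI conjI)
      fix t :: real assume t: "t > 0"
      show "complex_of_real t \<in> A"
        using t sum_pos[of t] by (simp add: A_def S_real)
      show "exp (Ln (S (of_real t)) / of_real t) = of_real (power_norm t us)"
        using sum_pos[of t] by (simp add: S_real Ln_of_real power_norm_def powr_def
            flip: of_real_divide exp_of_real)
    qed
  qed
qed

text \<open>Along U the imaginary part of each complex derivative vanishes, so the complex
  derivatives restrict to the real ones. This yields smoothness, and it lets real derivatives
  determine Taylor coefficients.\<close>

lemma holomorphic_extension_higher_deriv:
  fixes f :: "real \<Rightarrow> real"
  assumes A: "open A" "F holomorphic_on A" and U: "open U"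
    and ext: "\<forall>t\<in>U. complex_of_real t \<in> A \<and> F (of_real t) = of_real (f t)"
  shows "\<forall>t\<in>U. times_differentiable_at n f t \<and>
    (deriv ^^ n) F (of_real t) = of_real ((deriv ^^ n) f t)"
proof (induction n)
  case 0
  then show ?case using ext by simp
next
  case (Suc n)
  let ?G = "(deriv ^^ n) F" and ?g = "(deriv ^^ n) f"
  show ?case
  proof
    fix t assume t: "t \<in> U"
    have "(?G has_field_derivative deriv ?G (of_real t)) (at (of_real t))"
      using t ext by (intro holomorphic_derivI[OF holomorphic_higher_deriv[OF A(2,1)] A(1)]) auto
    then have vec: "((\<lambda>x. ?G (of_real x)) has_vector_derivative deriv ?G (of_real t)) (at t)"
      by (rule has_vector_derivative_real_field)
    have re: "((\<lambda>x. Re (?G (of_real x))) has_real_derivative Re (deriv ?G (of_real t))) (at t)"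
      and im: "((\<lambda>x. Im (?G (of_real x))) has_real_derivative Im (deriv ?G (of_real t))) (at t)"
      using bounded_linear.has_vector_derivative[OF bounded_linear_Re vec]
        bounded_linear.has_vector_derivative[OF bounded_linear_Im vec]
      by (simp_all add: has_real_derivative_iff_has_vector_derivative)
    have der: "(?g has_real_derivative Re (deriv ?G (of_real t))) (at t)"
      by (rule has_field_derivative_transform_within_open[OF re U t]) (use Suc in simp)
    have "((\<lambda>x. 0) has_real_derivative Im (deriv ?G (of_real t))) (at t)"
      by (rule has_field_derivative_transform_within_open[OF im U t]) (use Suc in simp)
    then have "Im (deriv ?G (of_real t)) = 0" using DERIV_unique DERIV_const by blast
    then have "deriv ?G (of_real t) = of_real (deriv ?g t)"
      using DERIV_imp_deriv[OF der] by (simp add: complex_eq_iff)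
    moreover have "\<forall>\<^sub>F x in nhds t. times_differentiable_at n f x"
      using eventually_nhds_in_open[OF U t] by eventually_elim (use Suc in blast)
    moreover have "?g differentiable (at t)"
      using der by (auto simp: real_differentiable_def)
    ultimately show "times_differentiable_at (Suc n) f t \<and>
        (deriv ^^ Suc n) F (of_real t) = of_real ((deriv ^^ Suc n) f t)"
      by simp
  qed
qed

lemma infinitely_differentiable_power_norm:
  assumes pos: "\<forall>u\<in>set us. u > 0" and s: "s > 0"
    and ev: "\<forall>\<^sub>F t in nhds s. f t = power_norm t us"
  shows "infinitely_differentiable_at f s"
proof -
  obtain F A where F: "open A" "F holomorphic_on A"
    "\<forall>t>0. complex_of_real t \<in> A \<and> F (of_real t) = of_real (power_norm t us)"
    by (rule power_norm_holomorphic_extension[OF pos])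
  obtain U where U: "open U" "s \<in> U" "\<forall>t\<in>U. f t = power_norm t us"
    using ev unfolding eventually_nhds by auto
  have "\<forall>t\<in>U \<inter> {0<..}. times_differentiable_at n f t \<and>
      (deriv ^^ n) F (of_real t) = of_real ((deriv ^^ n) f t)" for n
    by (rule holomorphic_extension_higher_deriv[OF F(1,2)]) (use F(3) U in auto)
  then show ?thesis using U(2) s by (auto simp: infinitely_differentiable_at_def)
qed

lemma higher_deriv_cong_open:
  assumes "open U" "\<forall>t\<in>U. f t = g t"
  shows "\<forall>t\<in>U. (deriv ^^ n) f t = (deriv ^^ n) (g :: real \<Rightarrow> real) t"
proof (induction n)
  case (Suc n)
  show ?case
  proof
    fix t assume "t \<in> U"
    then have "\<forall>\<^sub>F x in nhds t. x \<in> U" by (rule eventually_nhds_in_open[OF assms(1)])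
    then have "\<forall>\<^sub>F x in nhds t. (deriv ^^ n) f x = (deriv ^^ n) g x"
      by (rule eventually_mono) (use Suc in blast)
    from deriv_cong_ev[OF this refl] show "(deriv ^^ Suc n) f t = (deriv ^^ Suc n) g t" by simp
  qed
qed (use assms in simp)

lemma infinitely_differentiable_isCont:
  "infinitely_differentiable_at f s \<Longrightarrow> isCont ((deriv ^^ n) f) s"
proof -
  assume "infinitely_differentiable_at f s"
  then have "times_differentiable_at (Suc n) f s" unfolding infinitely_differentiable_at_def by blast
  then show ?thesis by (simp add: differentiable_imp_continuous_within)
qed

text \<open>Both n-th derivatives are continuous at s and agree on I, so they have the same limit
  along F. The filter F stands for \<open>at_left s\<close> or \<open>at_right s\<close>.\<close>

lemma higher_deriv_eq_one_sided:
  assumes "infinitely_differentiable_at f s" "infinitely_differentiable_at g s"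
    and I: "open I" "\<forall>t\<in>I. f t = g t" and F: "F \<le> at s" "F \<noteq> bot" "\<forall>\<^sub>F t in F. t \<in> I"
  shows "(deriv ^^ n) f s = (deriv ^^ n) g s"
proof -
  have lim: "((deriv ^^ n) h \<longlongrightarrow> (deriv ^^ n) h s) F" if "infinitely_differentiable_at h s" for h
    using infinitely_differentiable_isCont[OF that, of n] F(1) unfolding isCont_def
    by (rule tendsto_mono[rotated])
  have "\<forall>\<^sub>F t in F. (deriv ^^ n) f t = (deriv ^^ n) g t"
    using F(3) higher_deriv_cong_open[OF I, of n] by (auto elim: eventually_mono)
  then have "((deriv ^^ n) f \<longlongrightarrow> (deriv ^^ n) g s) F"
    using lim[OF assms(2)] by (subst tendsto_cong)
  then show ?thesis using tendsto_unique[OF F(2) lim[OF assms(1)]] by simp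
qed

text \<open>The difference extends holomorphically to a disc around s. Near s it vanishes
  identically or has no zero except possibly s; in the second case it keeps its sign on connected
  sets by the intermediate value theorem. Quantifying over I serves both sides of s.\<close>

lemma power_norm_sign_constant:
  assumes pos: "\<forall>u\<in>set us. u > 0" "\<forall>v\<in>set vs. v > 0" and s: "s > 0"
  obtains r where "r > 0" "\<forall>I. connected I \<longrightarrow> I \<subseteq> {s - r<..<s + r} - {s} \<longrightarrow>
    (\<forall>t\<in>I. power_norm t us \<le> power_norm t vs) \<or> (\<forall>t\<in>I. power_norm t vs \<le> power_norm t us)"
proof -
  obtain F A where F: "open A" "F holomorphic_on A"
    "\<forall>t>0. complex_of_real t \<in> A \<and> F (of_real t) = of_real (power_norm t us)"
    by (rule power_norm_holomorphic_extension[OF pos(1)])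
  obtain G B where G: "open B" "G holomorphic_on B"
    "\<forall>t>0. complex_of_real t \<in> B \<and> G (of_real t) = of_real (power_norm t vs)"
    by (rule power_norm_holomorphic_extension[OF pos(2)])
  define h where "h = (\<lambda>z. F z - G z)"
  have h_hol: "h holomorphic_on (A \<inter> B)"
    unfolding h_def using F G by (intro holomorphic_intros) (auto elim: holomorphic_on_subset)
  have "open (A \<inter> B)" "complex_of_real s \<in> A \<inter> B" using F G s by auto
  then obtain q where q: "q > 0" "ball (complex_of_real s) q \<subseteq> A \<inter> B"
    using open_contains_ball by blast
  let ?S = "ball (complex_of_real s) q"
  have hS: "h holomorphic_on ?S" by (rule holomorphic_on_subset[OF h_hol q(2)])
  have "\<exists>r>0. r \<le> q \<and> ((\<forall>z\<in>ball (complex_of_real s) r. h z = 0) \<or>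
      (\<forall>z\<in>ball (complex_of_real s) r - {of_real s}. h z \<noteq> 0))"
  proof (cases "h (of_real s) = 0")
    case True
    show ?thesis
    proof (cases "\<forall>z\<in>?S. h z = 0")
      case False
      then obtain w where w: "w \<in> ?S" "h w \<noteq> 0" by blast
      obtain r where r: "0 < r" "ball (complex_of_real s) r \<subseteq> ?S"
        "\<And>z. z \<in> ball (complex_of_real s) r - {of_real s} \<Longrightarrow> h z \<noteq> 0"
        by (rule isolated_zeros[OF hS open_ball connected_ball _ True w]) (use q in auto)
      show ?thesis by (rule exI[of _ "min r q"]) (use r q in auto)
    qed (use q in auto)
  next
    case False
    have "isCont h (of_real s)"
      using hS q(1) by (metis centre_in_ball continuous_on_eq_continuous_at holomorphic_on_imp_continuous_on open_ball)
    then obtain r where "r > 0" "\<forall>z. dist (complex_of_real s) z < r \<longrightarrow> h z \<noteq> 0"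
      using continuous_at_avoid[of "complex_of_real s" h 0] False by blast
    then show ?thesis using q by (intro exI[of _ "min r q"]) auto
  qed
  then obtain r where r: "r > 0" "r \<le> q" "(\<forall>z\<in>ball (complex_of_real s) r. h z = 0) \<or>
      (\<forall>z\<in>ball (complex_of_real s) r - {of_real s}. h z \<noteq> 0)" by blast
  \<comment> \<open>At most s, so that the interval stays within the positive reals.\<close>
  define r' where "r' = min r s"
  have r': "r' > 0" "r' \<le> r" "r' \<le> s" using r s by (auto simp: r'_def)
  define g where "g = (\<lambda>t. power_norm t us - power_norm t vs)"
  have hg: "h (of_real t) = of_real (g t)" if "t > 0" for t
    using F(3) G(3) that by (simp add: h_def g_def)
  show ?thesis
  proof (rule that[OF r'(1)], intro allI impI)
    fix I assume I: "connected I" "I \<subseteq> {s - r'<..<s + r'} - {s}"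
    have I_pos: "t > 0" if "t \<in> I" for t using I(2) r' that by auto
    have I_ball: "complex_of_real t \<in> ball (of_real s) r - {of_real s}" if "t \<in> I" for t
      using I(2) r' that by (auto simp: dist_of_real dist_real_def abs_if)
    have "(\<forall>t\<in>I. g t \<le> 0) \<or> (\<forall>t\<in>I. 0 \<le> g t)"
    proof (rule ccontr)
      assume "\<not> ?thesis"
      then obtain t1 t2 where t: "t1 \<in> I" "t2 \<in> I" "g t1 < 0" "0 < g t2" by (auto simp: not_le)
      have "continuous_on I (\<lambda>t. Re (h (of_real t)))"
      proof (intro continuous_intros)
        show "continuous_on I (\<lambda>t. h (of_real t))"
          by (rule continuous_on_compose2[OF holomorphic_on_imp_continuous_on[OF hS]])
            (use I_ball r(2) in \<open>force intro!: continuous_intros\<close>)+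
      qed
      then have "continuous_on I g" by (rule continuous_on_eq) (simp add: hg I_pos)
      then have "connected (g ` I)" using I(1) by (rule connected_continuous_image)
      then have "{g t1..g t2} \<subseteq> g ` I" using t by (intro connected_contains_Icc) auto
      moreover have "0 \<in> {g t1..g t2}" using t by simp
      ultimately have "0 \<in> g ` I" by blast
      then obtain t0 where t0: "t0 \<in> I" "g t0 = 0" by (metis imageE)
      then have "h (of_real t0) = 0" using hg[OF I_pos] by simp
      then have "\<forall>z\<in>ball (complex_of_real s) r. h z = 0" using r(3) I_ball[OF t0(1)] by blast
      then have "h (of_real t1) = 0" using I_ball[OF t(1)] by blast
      then show False using hg[OF I_pos[OF t(1)]] t(3) by simp
    qed
    then show "(\<forall>t\<in>I. power_norm t us \<le> power_norm t vs) \<or> (\<forall>t\<in>I. power_norm t vs \<le> power_norm t us)"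
      by (simp add: g_def)
  qed
qed

lemma finite_total_preorder_least:
  assumes "finite T" "T \<noteq> {}" "\<And>u v. u \<in> T \<Longrightarrow> v \<in> T \<Longrightarrow> R u v \<or> R v u"
    and "\<And>u v w. R u v \<Longrightarrow> R v w \<Longrightarrow> R u w"
  shows "\<exists>u\<in>T. \<forall>v\<in>T. R u v"
  using assms(1-3)
proof (induction T rule: finite_ne_induct)
  case (insert x T)
  then obtain u where u: "u \<in> T" "\<forall>v\<in>T. R u v" by auto
  show ?case
  proof (cases "R x u")
    case True
    then have "\<forall>v\<in>insert x T. R x v" using u assms(4) insert.prems by blast
    then show ?thesis by blast
  next
    case False
    then have "R u x" using u insert.prems by blast
    then show ?thesis using u by blast
  qed
qed blast

lemma finite_uniform_radius:
  fixes Q :: "'a \<Rightarrow> real \<Rightarrow> bool"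
  assumes "finite P" "\<And>p. p \<in> P \<Longrightarrow> \<exists>r>0. Q p r" "\<And>p r r'. Q p r \<Longrightarrow> 0 < r' \<Longrightarrow> r' \<le> r \<Longrightarrow> Q p r'"
  shows "\<exists>r>0. \<forall>p\<in>P. Q p r"
  using assms(1,2)
proof (induction P rule: finite_induct)
  case empty
  then show ?case by (auto intro: exI[of _ 1])
next
  case (insert p P)
  obtain r1 where r1: "r1 > 0" "Q p r1" using insert.prems by auto
  obtain r2 where r2: "r2 > 0" "\<forall>p\<in>P. Q p r2" using insert.IH insert.prems by auto
  have "Q p' (min r1 r2)" if "p' \<in> insert p P" for p'
    using that assms(3)[OF r1(2), of "min r1 r2"] assms(3)[of p' r2 "min r1 r2"] r1 r2 by auto
  then show ?case using r1 r2 by (intro exI[of _ "min r1 r2"]) auto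
qed

lemma Min_power_norm_smooth_imp_uniform:
  assumes T: "finite T" "T \<noteq> {}" "\<forall>us\<in>T. \<forall>u\<in>set us. u > 0" and s: "s > 0"
    and ev: "\<forall>\<^sub>F t in nhds s. f t = Min (power_norm t ` T)"
    and smooth: "infinitely_differentiable_at f s"
  obtains us where "us \<in> T" "\<forall>\<^sub>F t in nhds s. f t = power_norm t us"
proof -
  define Q where "Q = (\<lambda>(us, vs) r. \<forall>I. connected I \<longrightarrow> I \<subseteq> {s - r<..<s + r} - {s} \<longrightarrow>
    (\<forall>t\<in>I. power_norm t us \<le> power_norm t vs) \<or> (\<forall>t\<in>I. power_norm t vs \<le> power_norm t us))"
  have "\<exists>r>0. \<forall>p\<in>T \<times> T. Q p r"
  proof (rule finite_uniform_radius)
    fix p assume p: "p \<in> T \<times> T"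
    obtain us vs where p_eq: "p = (us, vs)" by (cases p)
    have pos: "\<forall>u\<in>set us. u > 0" "\<forall>v\<in>set vs. v > 0" using T(3) p p_eq by auto
    show "\<exists>r>0. Q p r"
      by (rule power_norm_sign_constant[OF pos s]) (auto simp: Q_def p_eq)
  next
    fix p r r' assume "Q p r" "0 < r'" "r' \<le> r"
    moreover have "{s - r'<..<s + r'} - {s} \<subseteq> {s - r<..<s + r} - {s}" using \<open>r' \<le> r\<close> by auto
    ultimately show "Q p r'" unfolding Q_def by (auto split: prod.splits)
  qed (use T in simp)
  then obtain r0 where r0: "r0 > 0" "\<And>us vs. us \<in> T \<Longrightarrow> vs \<in> T \<Longrightarrow> Q (us, vs) r0" by blast
  obtain r1 where r1: "r1 > 0" "\<And>t. dist t s < r1 \<Longrightarrow> f t = Min (power_norm t ` T)"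
    using ev unfolding eventually_nhds_metric by blast
  define r where "r = min r0 r1"
  have r: "r > 0" "r \<le> r0" "r \<le> r1" using r0 r1 by (auto simp: r_def)
  have side: "\<exists>us\<in>T. \<forall>t\<in>I. f t = power_norm t us"
    if I: "connected I" "I \<subseteq> {s - r<..<s + r} - {s}" for I
  proof -
    have "I \<subseteq> {s - r0<..<s + r0} - {s}" using I(2) r by auto
    \<comment> \<open>Comparison on all of I is total and transitive, so one norm is least
      throughout I.\<close>
    then have "\<exists>us\<in>T. \<forall>vs\<in>T. \<forall>t\<in>I. power_norm t us \<le> power_norm t vs"
      using r0(2) I(1) by (intro finite_total_preorder_least T) (auto simp: Q_def intro: order_trans)
    then obtain us where us: "us \<in> T" "\<And>vs t. vs \<in> T \<Longrightarrow> t \<in> I \<Longrightarrow> power_norm t us \<le> power_norm t vs"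
      by blast
    have "f t = power_norm t us" if t: "t \<in> I" for t
    proof -
      have "dist t s < r1" using I(2) t r by (auto simp: dist_real_def abs_if)
      then have "f t = Min (power_norm t ` T)" by (rule r1(2))
      also have "\<dots> = power_norm t us" using us t T(1) by (intro Min_eqI) auto
      finally show ?thesis .
    qed
    then show ?thesis using us(1) by blast
  qed
  obtain us where us: "us \<in> T" "\<forall>t\<in>{s<..<s + r}. f t = power_norm t us"
    using side[of "{s<..<s + r}"] r(1) by force
  obtain vs where vs: "vs \<in> T" "\<forall>t\<in>{s - r<..<s}. f t = power_norm t vs"
    using side[of "{s - r<..<s}"] r(1) by force
  have smooth_pn: "infinitely_differentiable_at (\<lambda>t. power_norm t ws) s" if "ws \<in> T" for ws
    using T(3) that s by (intro infinitely_differentiable_power_norm[of ws]) auto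
  have der_us: "(deriv ^^ n) f s = (deriv ^^ n) (\<lambda>t. power_norm t us) s" for n
    by (rule higher_deriv_eq_one_sided[OF smooth smooth_pn[OF us(1)] _ us(2), of "at_right s"])
      (use r(1) eventually_at_right_real[of s "s + r"] in \<open>auto simp: at_le\<close>)
  have der_vs: "(deriv ^^ n) f s = (deriv ^^ n) (\<lambda>t. power_norm t vs) s" for n
    by (rule higher_deriv_eq_one_sided[OF smooth smooth_pn[OF vs(1)] _ vs(2), of "at_left s"])
      (use r(1) eventually_at_left_real[of "s - r" s] in \<open>auto simp: at_le\<close>)
  obtain F A where F: "open A" "F holomorphic_on A"
    "\<forall>t>0. complex_of_real t \<in> A \<and> F (of_real t) = of_real (power_norm t us)"
    by (rule power_norm_holomorphic_extension) (use T(3) us(1) in auto)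
  obtain G B where G: "open B" "G holomorphic_on B"
    "\<forall>t>0. complex_of_real t \<in> B \<and> G (of_real t) = of_real (power_norm t vs)"
    by (rule power_norm_holomorphic_extension) (use T(3) vs(1) in auto)
  have "open (A \<inter> B)" "complex_of_real s \<in> A \<inter> B" using F G s by auto
  then obtain q where q: "q > 0" "ball (complex_of_real s) q \<subseteq> A \<inter> B"
    using open_contains_ball by blast
  have derF: "(deriv ^^ n) F (of_real s) = of_real ((deriv ^^ n) (\<lambda>t. power_norm t us) s)" for n
    using holomorphic_extension_higher_deriv[OF F(1,2), of "{0<..}" "\<lambda>t. power_norm t us" n] F(3) s by auto
  have derG: "(deriv ^^ n) G (of_real s) = of_real ((deriv ^^ n) (\<lambda>t. power_norm t vs) s)" for n
    using holomorphic_extension_higher_deriv[OF G(1,2), of "{0<..}" "\<lambda>t. power_norm t vs" n] G(3) s by auto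
  \<comment> \<open>The derivatives of f at s link those of both extensions, which therefore have
    the same Taylor series.\<close>
  have FG: "F z = G z" if "z \<in> ball (of_real s) q" for z
  proof (rule holomorphic_fun_eq_on_ball[OF _ _ that])
    show "F holomorphic_on ball (of_real s) q" "G holomorphic_on ball (of_real s) q"
      using F(2) G(2) q(2) by (auto elim!: holomorphic_on_subset)
    show "(deriv ^^ n) F (of_real s) = (deriv ^^ n) G (of_real s)" for n
      using der_us[of n] der_vs[of n] by (simp add: derF derG)
  qed
  \<comment> \<open>The bound q keeps t in the disc where the extensions agree, the bound s keeps it
    positive.\<close>
  define d where "d = min r (min q s)"
  have d: "d > 0" "d \<le> r" "d \<le> q" "d \<le> s" using r q s by (auto simp: d_def)
  have "f t = power_norm t us" if t: "dist t s < d" for t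
  proof -
    have bounds: "s - d < t" "t < s + d" using t by (auto simp: dist_real_def abs_if split: if_splits)
    consider "t = s" | "t \<in> {s<..<s + r}" | "t \<in> {s - r<..<s}" using bounds d by force
    then show ?thesis
    proof cases
      case 1
      \<comment> \<open>The point s belongs to neither side; order 0 of the equality of derivatives
        gives the value there.\<close>
      then show ?thesis using der_us[of 0] by simp
    next
      case 2
      then show ?thesis using us(2) by blast
    next
      case 3
      have tb: "complex_of_real t \<in> ball (of_real s) q" and "t > 0"
        using bounds d by (auto simp: dist_of_real dist_real_def abs_if)
      then have "complex_of_real (power_norm t us) = of_real (power_norm t vs)"
        using FG[OF tb] F(3) G(3) by metis
      then show ?thesis using vs(2) 3 by simp
    qed
  qed
  then have "\<forall>\<^sub>F t in nhds s. f t = power_norm t us"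
    using d(1) unfolding eventually_nhds_metric by blast
  then show ?thesis using that us(1) by blast
qed

section \<open>Power norms and finitely supported sequences\<close>

lemma seq_norm_eq_power_norm:
  assumes "x \<in> finsupp_seqs"
  obtains us where "\<forall>u\<in>set us. u > 0" "\<forall>t. seq_norm (ereal t) x = power_norm t us"
proof
  let ?N = "{n. x n \<noteq> 0}"
  let ?us = "map (\<lambda>n. \<bar>x n\<bar>) (sorted_list_of_set ?N)"
  have N: "finite ?N" using assms by (simp add: finsupp_seqs_def)
  then show "\<forall>u\<in>set ?us. u > 0" by auto
  show "\<forall>t. seq_norm (ereal t) x = power_norm t ?us"
  proof
    fix t
    have "(\<Sum>n. \<bar>x n\<bar> powr t) = (\<Sum>n\<in>?N. \<bar>x n\<bar> powr t)"
      by (rule suminf_finite[OF N]) simp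
    also have "\<dots> = (\<Sum>u\<leftarrow>?us. u powr t)"
      using N by (simp add: o_def sum_list_distinct_conv_sum_set)
    finally show "seq_norm (ereal t) x = power_norm t ?us"
      by (simp add: seq_norm_def power_norm_def)
  qed
qed

lemma power_norm_eq_seq_norm:
  assumes "\<forall>u\<in>set us. u > 0"
  obtains x where "x \<in> finsupp_seqs" "\<forall>t. seq_norm (ereal t) x = power_norm t us"
proof
  let ?x = "\<lambda>n. if n < length us then us ! n else 0"
  show "?x \<in> finsupp_seqs"
    unfolding finsupp_seqs_def by (auto intro: finite_subset[of _ "{..<length us}"])
  show "\<forall>t. seq_norm (ereal t) ?x = power_norm t us"
  proof
    fix t
    have "(\<Sum>n. \<bar>?x n\<bar> powr t) = (\<Sum>n<length us. \<bar>?x n\<bar> powr t)"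
      by (rule suminf_finite) auto
    also have "\<dots> = (\<Sum>n<length us. (us ! n) powr t)"
      using assms by (intro sum.cong) (auto simp: less_imp_le)
    also have "\<dots> = (\<Sum>u\<leftarrow>us. u powr t)"
      by (simp add: sum_list_sum_nth atLeast0LessThan)
    finally show "seq_norm (ereal t) ?x = power_norm t us"
      by (simp add: seq_norm_def power_norm_def)
  qed
qed

text \<open>Near a finite s, a neighborhood in (0, \<infinity>] can be replaced by the image of a
  real one, so only real exponents are compared.\<close>

lemma alpha_standard_iff_power_norm:
  assumes s: "s > 0"
  shows "alpha_standard \<alpha> (ereal s) \<longleftrightarrow>
    (\<exists>us. (\<forall>u\<in>set us. u > 0) \<and> (\<forall>\<^sub>F t in nhds s. mahler_mu \<alpha> (ereal t) = power_norm t us))"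
proof
  assume "alpha_standard \<alpha> (ereal s)"
  then obtain U where U: "openin (top_of_set {0<..}) U" "ereal s \<in> U" "alpha_uniform \<alpha> U"
    by (auto simp: alpha_standard_def)
  then obtain x where x: "x \<in> finsupp_seqs" "\<forall>t\<in>U. mahler_mu \<alpha> t = seq_norm t x"
    by (auto simp: alpha_uniform_def)
  have "open U" using U(1) by (simp add: openin_open_eq)
  then have "open (ereal -` U)" by (rule open_ereal_vimage)
  then have "\<forall>\<^sub>F t in nhds s. t \<in> ereal -` U" using U(2) by (intro eventually_nhds_in_open) auto
  moreover obtain us where us: "\<forall>u\<in>set us. u > 0" "\<forall>t. seq_norm (ereal t) x = power_norm t us"
    by (rule seq_norm_eq_power_norm[OF x(1)])
  ultimately have "\<forall>\<^sub>F t in nhds s. mahler_mu \<alpha> (ereal t) = power_norm t us"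
    using x(2) by (auto elim!: eventually_mono)
  then show "\<exists>us. (\<forall>u\<in>set us. u > 0) \<and> (\<forall>\<^sub>F t in nhds s. mahler_mu \<alpha> (ereal t) = power_norm t us)"
    using us(1) by blast
next
  assume "\<exists>us. (\<forall>u\<in>set us. u > 0) \<and> (\<forall>\<^sub>F t in nhds s. mahler_mu \<alpha> (ereal t) = power_norm t us)"
  then obtain us where us: "\<forall>u\<in>set us. u > 0"
    "\<forall>\<^sub>F t in nhds s. mahler_mu \<alpha> (ereal t) = power_norm t us" by blast
  obtain V where V: "open V" "s \<in> V" "\<forall>t\<in>V. mahler_mu \<alpha> (ereal t) = power_norm t us"
    using us(2) unfolding eventually_nhds by blast
  obtain x where x: "x \<in> finsupp_seqs" "\<forall>t. seq_norm (ereal t) x = power_norm t us"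
    by (rule power_norm_eq_seq_norm[OF us(1)])
  let ?U = "ereal ` (V \<inter> {0<..})"
  have "open ?U" using V(1) by (intro open_ereal) auto
  then have "openin (top_of_set {0<..}) ?U" by (auto simp: openin_open_eq)
  moreover have "ereal s \<in> ?U" using V(2) s by auto
  moreover have "alpha_uniform \<alpha> ?U"
    unfolding alpha_uniform_def using V(3) x by (auto intro!: bexI[of _ x])
  ultimately show "alpha_standard \<alpha> (ereal s)" unfolding alpha_standard_def by blast
qed

theorem theorem1p6:
  fixes \<alpha> :: complex and s :: real
  assumes "algebraic \<alpha>" and "\<alpha> \<noteq> 0" and "s > 0"
  shows "alpha_standard \<alpha> (ereal s) \<longleftrightarrow>
         infinitely_differentiable_at (\<lambda>t. mahler_mu \<alpha> (ereal t)) s"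
proof
  assume "alpha_standard \<alpha> (ereal s)"
  then obtain us where "\<forall>u\<in>set us. u > 0" "\<forall>\<^sub>F t in nhds s. mahler_mu \<alpha> (ereal t) = power_norm t us"
    unfolding alpha_standard_iff_power_norm[OF assms(3)] by blast
  then show "infinitely_differentiable_at (\<lambda>t. mahler_mu \<alpha> (ereal t)) s"
    by (intro infinitely_differentiable_power_norm[OF _ assms(3)])
next
  assume smooth: "infinitely_differentiable_at (\<lambda>t. mahler_mu \<alpha> (ereal t)) s"
  \<comment> \<open>Any bound beyond s would do; s + 1 leaves room for a neighborhood of s.\<close>
  obtain T where T: "finite T" "T \<noteq> {}" "\<forall>us\<in>T. \<forall>u\<in>set us. u > 0"
    "\<forall>t. 0 < t \<and> t \<le> s + 1 \<longrightarrow> metric_mahler t \<alpha> = Min (power_norm t ` T)"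
    by (rule metric_mahler_eq_Min[OF assms(1,2)])
  have "\<forall>\<^sub>F t in nhds s. t \<in> {0<..<s + 1}"
    using assms(3) by (intro eventually_nhds_in_open) auto
  then have "\<forall>\<^sub>F t in nhds s. mahler_mu \<alpha> (ereal t) = Min (power_norm t ` T)"
    by eventually_elim (use T(4) in \<open>simp add: mahler_mu_def\<close>)
  then obtain us where "us \<in> T" "\<forall>\<^sub>F t in nhds s. mahler_mu \<alpha> (ereal t) = power_norm t us"
    by (rule Min_power_norm_smooth_imp_uniform[OF T(1-3) assms(3) _ smooth])
  then show "alpha_standard \<alpha> (ereal s)"
    unfolding alpha_standard_iff_power_norm[OF assms(3)] using T(3) by blast
qed

end
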